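(* Let $n \geq 2$ be a positive integer. There exists a $\chi_{ig}^{AB}$-mixed-game-vertex-critical graph $G$ such that $$\left\{\chi_{ig}^{AB}(G)-\chi_{ig}^{AB}(G-x) \, | \, x \in V(G)\right\}=\{1,-2n+3,-2n+1\}.$$
   Context: All graphs are simple, undirected and finite. The AB-independence coloring game on a graph $G$ is played by Alice and Bob in rounds, round $i$ being played with color $i$ ($i=1,2,\ldots$). Within a round the players alternate moves, each move consisting of coloring a previously uncolored vertex with the color of the round so that the vertices colored in the same round form an independent set. A round is completed when no uncolored vertex can be given the color of the round (every uncolored vertex is adjacent to a vertex colored in this round). The game is over when all vertices are colored. Alice starts the first round and each further round is started by the player who did not make the last move of the previous round. Alice wants to finish in as few rounds as possible, Bob in as many rounds as possible. The number of rounds when both players play optimally is the AB-independence game chromatic number $\chi_{ig}^{AB}(G)$. For $x\in V(G)$, $G-x$ is the graph obtained from $G$ by deleting $x$ and all edges incident with $x$. A graph $G$ is $\chi_{ig}^{AB}$-mixed-game-vertex-critical if $\chi_{ig}^{AB}(G-x)\neq\chi_{ig}^{AB}(G)$ for every $x\in V(G)$, and there exist $y,y'\in V(G)$ with $\chi_{ig}^{AB}(G-y)<\chi_{ig}^{AB}(G)$ and $\chi_{ig}^{AB}(G-y')>\chi_{ig}^{AB}(G)$. *)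

theory Defs
  imports Main
begin

record 'a graph =
  verts :: "'a set"
  edges :: "'a set set"

definition simple_graph :: "'a graph \<Rightarrow> bool" where
  "simple_graph G \<longleftrightarrow> finite (verts G) \<and> (\<forall>e\<in>edges G. e \<subseteq> verts G \<and> card e = 2)"

definition delete_vertex :: "'a graph \<Rightarrow> 'a \<Rightarrow> 'a graph" where
  "delete_vertex G x = \<lparr>verts = verts G - {x}, edges = {e \<in> edges G. x \<notin> e}\<rparr>"

definition independent_set :: "'a graph \<Rightarrow> 'a set \<Rightarrow> bool" where
  "independent_set G S \<longleftrightarrow> pairwise (\<lambda>u v. {u, v} \<notin> edges G) S"

datatype player = Alice | Bob

fun opponent :: "player \<Rightarrow> player" where
  "opponent Alice = Bob"
| "opponent Bob = Alice"

text \<open>Alice minimises and Bob maximises the number of rounds; used on finite nonempty sets only.\<close>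

fun best :: "player \<Rightarrow> nat set \<Rightarrow> nat" where
  "best Alice A = Min A"
| "best Bob A = Max A"

text \<open>A position consists of the player \<open>p\<close> to move, the set \<open>U\<close> of uncolored vertices and the
  set \<open>C\<close> of vertices colored in the current round. The vertices colored in earlier rounds
  have no influence on the rest of the game.\<close>

definition legal_moves :: "'a graph \<Rightarrow> 'a set \<Rightarrow> 'a set \<Rightarrow> 'a set" where
  "legal_moves G U C = {v \<in> U. independent_set G (insert v C)}"

text \<open>The number of rounds, including the current one, that are still to be completed under
  optimal play. When a round is completed, the player \<open>p\<close> to move is the one who did not make
  the last move, so \<open>p\<close> starts the next round. The game is over when \<open>U\<close> is empty and the last
  round has been counted (\<open>C = {}\<close>); the value for infinite \<open>U\<close> is a dummy.\<close>

function rounds_to_go :: "'a graph \<Rightarrow> player \<Rightarrow> 'a set \<Rightarrow> 'a set \<Rightarrow> nat" where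
  "rounds_to_go G p U C =
    (if infinite U \<or> U = {} \<and> C = {} then 0
     else if legal_moves G U C = {} then Suc (rounds_to_go G p U {})
     else best p ((\<lambda>v. rounds_to_go G (opponent p) (U - {v}) (insert v C)) ` legal_moves G U C))"
  by auto
termination
  by (relation "measures [\<lambda>(G, p, U, C). card U, \<lambda>(G, p, U, C). if C = {} then 0 else 1]")
    (auto simp: legal_moves_def independent_set_def card_gt_0_iff intro!: diff_less)

declare rounds_to_go.simps [simp del]

definition chi_ig_AB :: "'a graph \<Rightarrow> nat" where
  "chi_ig_AB G = rounds_to_go G Alice (verts G) {}"

definition mixed_game_vertex_critical :: "'a graph \<Rightarrow> bool" where
  "mixed_game_vertex_critical G \<longleftrightarrow>
    (\<forall>x\<in>verts G. chi_ig_AB (delete_vertex G x) \<noteq> chi_ig_AB G) \<and>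
    (\<exists>y\<in>verts G. chi_ig_AB (delete_vertex G y) < chi_ig_AB G) \<and>
    (\<exists>y'\<in>verts G. chi_ig_AB (delete_vertex G y') > chi_ig_AB G)"

end

theory Submission
  imports Defs
begin

text \<open>Write \<open>X\<^sub>k\<close> for \<open>K\<^bsub>k,k\<^esub>\<close> minus a perfect matching. The graph is the join of \<open>X\<^bsub>2n\<^esub>\<close> with the
  disjoint union \<open>R\<close> of \<open>X\<^sub>4\<close>, \<open>K\<^sub>2\<close> and \<open>K\<^sub>1\<close>. Each round takes place on one side of the join. If
  Bob answers every move on \<open>X\<^bsub>2n\<^esub>\<close> by the vertex matched to it, then \<open>X\<^bsub>2n\<^esub>\<close> lasts for \<open>2n\<close> rounds;
  if Alice is the one to answer, she takes a second vertex of the same side, and two rounds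
  suffice. Who has to open the play on \<open>X\<^bsub>2n\<^esub>\<close> is decided by the parity of the number of vertices
  of \<open>R\<close>. This number is odd, so deleting a vertex of \<open>R\<close> raises the number of rounds spent on
  \<open>X\<^bsub>2n\<^esub>\<close> from \<open>2\<close> to \<open>2n\<close>, while on \<open>R\<close> itself 3 rounds become 4 if the vertex is in \<open>K\<^sub>2\<close> and
  2 otherwise. Deleting a vertex of \<open>X\<^bsub>2n\<^esub>\<close> leaves Alice a side of odd size, with which she makes
  Bob open the play on \<open>R\<close>, and this saves one round.\<close>

section \<open>Rounds of the game\<close>

text \<open>The player on move after \<open>k\<close> further moves. The end of a round does not
  change whose turn it is, so this player also opens the next round, and only the parity of the
  moves in a round has to be tracked.\<close>

definition turn :: "player \<Rightarrow> nat \<Rightarrow> player" where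
  "turn p k = (if even k then p else opponent p)"

lemma opponent_opponent [simp]: "opponent (opponent p) = p"
  by (cases p) auto

lemma turn_0 [simp]: "turn p 0 = p"
  by (simp add: turn_def)

lemma turn_Suc: "turn p (Suc k) = turn (opponent p) k"
  by (simp add: turn_def)

lemma independent_set_iff:
  "independent_set G S \<longleftrightarrow> (\<forall>u\<in>S. \<forall>v\<in>S. u \<noteq> v \<longrightarrow> {u, v} \<notin> edges G)"
  by (auto simp: independent_set_def pairwise_def)

lemma independent_setD:
  "independent_set G S \<Longrightarrow> u \<in> S \<Longrightarrow> v \<in> S \<Longrightarrow> u \<noteq> v \<Longrightarrow> {u, v} \<notin> edges G"
  by (simp add: independent_set_iff)

lemma independent_set_mono: "independent_set G S \<Longrightarrow> T \<subseteq> S \<Longrightarrow> independent_set G T"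
  by (auto simp: independent_set_iff)

lemma independent_set_singleton [simp]: "independent_set G {v}"
  by (simp add: independent_set_def)

lemma independent_set_empty [simp]: "independent_set G {}"
  by (simp add: independent_set_def)

lemma legal_moves_empty [simp]: "legal_moves G U {} = U"
  by (simp add: legal_moves_def)

lemma finite_legal_moves: "finite U \<Longrightarrow> finite (legal_moves G U C)"
  by (simp add: legal_moves_def)

lemma best_in:
  assumes "finite A" "A \<noteq> {}"
  shows "best p A \<in> A"
  using assms by (cases p) auto

lemma rounds_to_go_empty [simp]: "rounds_to_go G p {} {} = 0"
  by (simp add: rounds_to_go.simps[of G p "{}" "{}"])

section \<open>Bounds on the value from single moves\<close>

lemma rounds_to_go_step:
  assumes "finite U" "legal_moves G U C \<noteq> {}"
  shows "rounds_to_go G p U C =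
    best p ((\<lambda>v. rounds_to_go G (opponent p) (U - {v}) (insert v C)) ` legal_moves G U C)"
proof -
  have "U \<noteq> {}" using assms(2) by (auto simp: legal_moves_def)
  then show ?thesis using assms by (subst rounds_to_go.simps) simp
qed

lemma rounds_to_go_round_end:
  assumes "finite U" "legal_moves G U C = {}" "U \<union> C \<noteq> {}"
  shows "rounds_to_go G p U C = Suc (rounds_to_go G p U {})"
  using assms by (subst rounds_to_go.simps) auto

lemma Alice_move:
  assumes "finite U" "v \<in> legal_moves G U C"
  shows "rounds_to_go G Alice U C \<le> rounds_to_go G Bob (U - {v}) (insert v C)"
proof -
  have "legal_moves G U C \<noteq> {}" using assms(2) by auto
  then show ?thesis
    using assms by (auto simp: rounds_to_go_step finite_legal_moves)
qed

lemma Bob_move: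
  assumes "finite U" "v \<in> legal_moves G U C"
  shows "rounds_to_go G Alice (U - {v}) (insert v C) \<le> rounds_to_go G Bob U C"
proof -
  have "legal_moves G U C \<noteq> {}" using assms(2) by auto
  then show ?thesis
    using assms by (auto simp: rounds_to_go_step finite_legal_moves)
qed

lemma optimal_move:
  assumes "finite U" "legal_moves G U C \<noteq> {}"
  obtains v where "v \<in> legal_moves G U C"
    "rounds_to_go G p U C = rounds_to_go G (opponent p) (U - {v}) (insert v C)"
proof -
  let ?A = "(\<lambda>v. rounds_to_go G (opponent p) (U - {v}) (insert v C)) ` legal_moves G U C"
  have "best p ?A \<in> ?A" using assms by (intro best_in) (auto simp: finite_legal_moves)
  then show ?thesis using that rounds_to_go_step[OF assms, of p] by auto
qed

lemma Alice_all_moves: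
  assumes "finite U" "legal_moves G U C \<noteq> {}"
    and "\<And>v. v \<in> legal_moves G U C \<Longrightarrow> b \<le> rounds_to_go G Bob (U - {v}) (insert v C)"
  shows "b \<le> rounds_to_go G Alice U C"
  using optimal_move[OF assms(1,2), of Alice] assms(3) by fastforce

lemma Bob_all_moves:
  assumes "finite U" "legal_moves G U C \<noteq> {}"
    and "\<And>v. v \<in> legal_moves G U C \<Longrightarrow> rounds_to_go G Alice (U - {v}) (insert v C) \<le> b"
  shows "rounds_to_go G Bob U C \<le> b"
  using optimal_move[OF assms(1,2), of Bob] assms(3) by fastforce

text \<open>\<open>maximal_class G U C S\<close>: the round in which \<open>C\<close> is already colored may end with \<open>S\<close>.\<close>

definition maximal_class :: "'a graph \<Rightarrow> 'a set \<Rightarrow> 'a set \<Rightarrow> 'a set \<Rightarrow> bool" where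
  "maximal_class G U C S \<longleftrightarrow> C \<subseteq> S \<and> S \<subseteq> C \<union> U \<and> independent_set G S \<and>
    (\<forall>u\<in>U - S. \<exists>s\<in>S. {u, s} \<in> edges G)"

lemma maximal_classD:
  assumes "maximal_class G U C S"
  shows "C \<subseteq> S" "S \<subseteq> C \<union> U" "\<And>u v. u \<in> S \<Longrightarrow> v \<in> S \<Longrightarrow> u \<noteq> v \<Longrightarrow> {u, v} \<notin> edges G"
    "\<And>u. u \<in> U \<Longrightarrow> (\<And>s. s \<in> S \<Longrightarrow> {u, s} \<notin> edges G) \<Longrightarrow> u \<in> S"
  using assms unfolding maximal_class_def independent_set_iff by blast+

lemma maximal_class_self:
  assumes "legal_moves G U C = {}" "independent_set G C"
  shows "maximal_class G U C C"
  unfolding maximal_class_def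
proof (intro conjI ballI)
  fix u assume u: "u \<in> U - C"
  then have "\<not> independent_set G (insert u C)" using assms(1) by (auto simp: legal_moves_def)
  then obtain c where "c \<in> C" "{u, c} \<in> edges G \<or> {c, u} \<in> edges G"
    using assms(2) unfolding independent_set_iff by blast
  then show "\<exists>s\<in>C. {u, s} \<in> edges G" by (auto simp: insert_commute)
qed (use assms(2) in auto)

text \<open>Following optimal play to the end of the round yields one maximal class
  \<open>S\<close>, reached after \<open>card (S - C)\<close> more moves. Which \<open>S\<close>
  arises is left open, so a bound that holds for every maximal class is a bound on the
  value.\<close>

lemma round_outcome:
  assumes "finite U" "U \<union> C \<noteq> {}" "U \<inter> C = {}" "independent_set G C"
  shows "\<exists>S. maximal_class G U C S \<and>
    rounds_to_go G p U C = Suc (rounds_to_go G (turn p (card (S - C))) (U - S) {})"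
  using assms
proof (induction "card U" arbitrary: p U C rule: less_induct)
  case less
  show ?case
  proof (cases "legal_moves G U C = {}")
    case True
    have "maximal_class G U C C"
      by (rule maximal_class_self) (use True less.prems in auto)
    moreover have "U - C = U" using less.prems by auto
    ultimately show ?thesis
      using rounds_to_go_round_end[OF less.prems(1) True less.prems(2), of p]
      by (intro exI[of _ C]) simp
  next
    case False
    obtain v where v: "v \<in> legal_moves G U C"
      and eq: "rounds_to_go G p U C = rounds_to_go G (opponent p) (U - {v}) (insert v C)"
      using optimal_move[OF less.prems(1) False] .
    have vU: "v \<in> U" "independent_set G (insert v C)"
      using v by (auto simp: legal_moves_def)
    have "card (U - {v}) < card U"
      using vU less.prems(1) by (meson card_Diff1_less)
    from less.hyps[OF this, of "insert v C" "opponent p"] obtain S where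
      S: "maximal_class G (U - {v}) (insert v C) S"
        "rounds_to_go G (opponent p) (U - {v}) (insert v C) =
          Suc (rounds_to_go G (turn (opponent p) (card (S - insert v C))) (U - {v} - S) {})"
      using less.prems vU by auto
    have vS: "v \<in> S" "v \<notin> C" using S(1) vU less.prems by (auto simp: maximal_class_def)
    have fin: "finite (S - C)"
      using S(1) less.prems(1) vU by (auto simp: maximal_class_def intro: finite_subset[of _ U])
    have "maximal_class G U C S"
      using S(1) vU by (auto simp: maximal_class_def)
    moreover have "card (S - C) = Suc (card (S - insert v C))"
      using vS fin by (metis Diff_insert DiffI card_Suc_Diff1)
    moreover have "U - {v} - S = U - S" using vS by auto
    ultimately show ?thesis using S(2) eq by (intro exI[of _ S]) (simp add: turn_Suc)
  qed
qed

lemma round_le: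
  assumes "finite U" "U \<union> C \<noteq> {}" "U \<inter> C = {}" "independent_set G C"
    and "\<And>S. maximal_class G U C S \<Longrightarrow>
      rounds_to_go G (turn p (card (S - C))) (U - S) {} \<le> b"
  shows "rounds_to_go G p U C \<le> Suc b"
  using round_outcome[OF assms(1-4), of p] assms(5) by fastforce

lemma round_ge:
  assumes "finite U" "U \<union> C \<noteq> {}" "U \<inter> C = {}" "independent_set G C"
    and "\<And>S. maximal_class G U C S \<Longrightarrow>
      b \<le> rounds_to_go G (turn p (card (S - C))) (U - S) {}"
  shows "Suc b \<le> rounds_to_go G p U C"
  using round_outcome[OF assms(1-4), of p] assms(5) by fastforce

section \<open>Bounds that hold for every course of play\<close>

lemma independent_le_1:
  assumes "finite U" "independent_set G U" "\<And>v. {v} \<notin> edges G"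
  shows "rounds_to_go G p U {} \<le> 1"
proof (cases "U = {}")
  case False
  have "U - S = {}" if "maximal_class G U {} S" for S
    using maximal_classD[OF that] assms(2,3) unfolding independent_set_iff
    by (metis Diff_eq_empty_iff insert_absorb2 subset_iff sup_bot_left)
  then have "rounds_to_go G (turn p (card (S - {}))) (U - S) {} \<le> 0"
    if "maximal_class G U {} S" for S using that by (metis le0 rounds_to_go_empty order_refl)
  then have "rounds_to_go G p U {} \<le> Suc 0"
    using assms(1) False by (intro round_le) auto
  then show ?thesis by simp
qed simp

lemma two_more_rounds:
  assumes "finite U" "U \<union> C \<noteq> {}" "U \<inter> C = {}" "independent_set G C" "\<And>v. {v} \<notin> edges G"
    and "\<And>S. maximal_class G U C S \<Longrightarrow> independent_set G (U - S)"
  shows "rounds_to_go G p U C \<le> 2"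
  using round_le[OF assms(1-4), of p 1] independent_le_1[of _ G] assms
  by (simp add: numeral_2_eq_2)

text \<open>A color class meets a clique in at most one vertex, so every round shortens
  \<open>Q\<close> by at most one, whoever moves.\<close>

lemma clique_le_rounds:
  assumes "finite U" "Q \<subseteq> U" "\<And>u v. u \<in> Q \<Longrightarrow> v \<in> Q \<Longrightarrow> u \<noteq> v \<Longrightarrow> {u, v} \<in> edges G"
  shows "card Q \<le> rounds_to_go G p U {}"
  using assms
proof (induction "card Q" arbitrary: p U Q)
  case 0
  then show ?case by simp
next
  case (Suc n)
  have "Suc n \<le> rounds_to_go G p U {}"
  proof (rule round_ge)
    fix S assume S: "maximal_class G U {} S"
    have "finite Q" using Suc.prems finite_subset by blast
    \<comment> \<open>If the class misses \<open>Q\<close>, an arbitrary vertex is given up, so that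
      the clique shrinks by exactly one in both cases.\<close>
    obtain v where v: "v \<in> Q" "S \<inter> Q \<subseteq> {v}"
    proof (cases "S \<inter> Q = {}")
      case True
      then show ?thesis using that Suc.hyps(2) by (metis card.empty empty_subsetI equals0I nat.distinct(1))
    next
      case False
      then obtain v where "v \<in> S" "v \<in> Q" by auto
      then show ?thesis using that[of v] maximal_classD(3)[OF S] Suc.prems(3) by blast
    qed
    have "n = card (Q - {v})" using v Suc.hyps(2) \<open>finite Q\<close> by simp
    moreover have "Q - {v} \<subseteq> U - S" using v Suc.prems by auto
    ultimately show "n \<le> rounds_to_go G (turn p (card (S - {}))) (U - S) {}"
      using Suc.hyps(1)[of "Q - {v}" "U - S"] Suc.prems by auto
  qed (use Suc in auto)
  then show ?case using Suc by simp
qed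

text \<open>The game only looks at edges between vertices of the current position. This allows the
  game on a vertex-deleted graph to be played inside the original graph.\<close>

lemma rounds_to_go_cong:
  assumes "\<And>u v. u \<in> U \<union> C \<Longrightarrow> v \<in> U \<union> C \<Longrightarrow> {u, v} \<in> edges G \<longleftrightarrow> {u, v} \<in> edges H"
  shows "rounds_to_go G p U C = rounds_to_go H p U C"
  using assms
proof (induction G p U C rule: rounds_to_go.induct)
  case (1 G p U C)
  show ?case
  proof (cases "infinite U \<or> U = {} \<and> C = {}")
    case True
    then show ?thesis by (subst (1 2) rounds_to_go.simps) simp
  next
    case nontrivial: False
    have leg: "legal_moves G U C = legal_moves H U C"
      using "1.prems" by (auto simp: legal_moves_def independent_set_iff)
    have fin: "finite U" and ne: "U \<union> C \<noteq> {}" using nontrivial by auto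
    show ?thesis
    proof (cases "legal_moves G U C = {}")
      case True
      have "rounds_to_go G p U {} = rounds_to_go H p U {}"
        by (rule "1.IH"(1)[OF nontrivial True]) (use "1.prems" in auto)
      then show ?thesis
        using True leg rounds_to_go_round_end[OF fin _ ne] by metis
    next
      case False
      have eq: "rounds_to_go G (opponent p) (U - {v}) (insert v C) =
          rounds_to_go H (opponent p) (U - {v}) (insert v C)" if "v \<in> legal_moves G U C" for v
        by (rule "1.IH"(2)[OF nontrivial False that])
          (use that "1.prems" in \<open>auto simp: legal_moves_def\<close>)
      show ?thesis
        unfolding rounds_to_go_step[OF fin False] rounds_to_go_step[OF fin False[unfolded leg]]
        using eq leg by (metis (mono_tags, lifting) image_cong)
    qed
  qed
qed

section \<open>Rounds in a join\<close>

text \<open>Minimum and maximum are monotone and commute with adding \<open>k\<close>. The relation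
  is a parameter so that upper and lower bounds for joins share one induction.\<close>

lemma best_shift_rel:
  fixes g h :: "'b \<Rightarrow> nat"
  assumes "rel = (\<le>) \<or> rel = (\<ge>)" "finite A" "A \<noteq> {}"
    and "\<And>v. v \<in> A \<Longrightarrow> rel (g v) (k + h v)"
  shows "rel (best p (g ` A)) (k + best p (h ` A))"
proof -
  have ex: "\<exists>v\<in>A. best p (f ` A) = f v \<and> (\<forall>w\<in>A. if p = Alice then f v \<le> f w else f w \<le> f v)"
    for f :: "'b \<Rightarrow> nat"
  proof -
    have "best p (f ` A) \<in> f ` A" using assms(2,3) by (intro best_in) auto
    then obtain v where v: "v \<in> A" "best p (f ` A) = f v" by auto
    have "if p = Alice then best p (f ` A) \<le> f w else f w \<le> best p (f ` A)" if "w \<in> A" for w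
      using that assms(2) by (cases p) auto
    then show ?thesis using v by auto
  qed
  obtain v where v: "v \<in> A" "best p (g ` A) = g v"
    "\<forall>w\<in>A. if p = Alice then g v \<le> g w else g w \<le> g v" using ex by blast
  obtain w where w: "w \<in> A" "best p (h ` A) = h w"
    "\<forall>v\<in>A. if p = Alice then h w \<le> h v else h v \<le> h w" using ex by blast
  \<comment> \<open>The optimal choices \<open>v\<close> for \<open>g\<close> and \<open>w\<close>
    for \<open>h\<close> are compared. If Alice moves and \<open>rel\<close> is \<le>, for instance,
    then \<open>g v \<le> g w \<le> k + h w\<close>; the other three cases are similar.\<close>
  have "g v \<le> g w \<and> h w \<le> h v \<or> g w \<le> g v \<and> h v \<le> h w"
    using v(3) w(3) v(1) w(1) by (cases "p = Alice") auto
  moreover have "rel (g v) (k + h v)" "rel (g w) (k + h w)"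
    using assms(4) v(1) w(1) by auto
  ultimately have "rel (g v) (k + h w)"
    using assms(1) by (elim disjE) auto
  then show ?thesis by (simp only: v(2) w(2))
qed

text \<open>Every vertex of \<open>X\<close> has a neighbor in \<open>C\<close> and is blocked until
  the round ends, so the games with and without \<open>X\<close> have the same moves. They are
  compared along the whole game tree, because optimal play in the two games may end the round with
  different classes.\<close>

lemma join_round:
  assumes "rel = (\<le>) \<or> rel = (\<ge>)"
    and "finite U" "C \<noteq> {}" "U \<inter> C = {}" "finite X" "X \<inter> U = {}" "X \<inter> C = {}"
      "independent_set G C"
    and "\<And>x. x \<in> X \<Longrightarrow> \<exists>c\<in>C. {x, c} \<in> edges G"
    and "\<And>S. maximal_class G U C S \<Longrightarrow>
      rel (rounds_to_go G (turn p (card (S - C))) (X \<union> (U - S)) {})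
        (k + rounds_to_go G (turn p (card (S - C))) (U - S) {})"
  shows "rel (rounds_to_go G p (X \<union> U) C) (k + rounds_to_go G p U C)"
  using assms(2-)
proof (induction "card U" arbitrary: p U C rule: less_induct)
  case less
  have leg: "legal_moves G (X \<union> U) C = legal_moves G U C"
  proof -
    have "x \<notin> legal_moves G (X \<union> U) C" if x: "x \<in> X" for x
    proof -
      obtain c where "c \<in> C" "{x, c} \<in> edges G" using less.prems(8)[OF x] by auto
      moreover have "x \<noteq> c" using \<open>c \<in> C\<close> x less.prems(6) by auto
      ultimately show ?thesis unfolding legal_moves_def independent_set_iff by blast
    qed
    then show ?thesis by (auto simp: legal_moves_def)
  qed
  show ?case
  proof (cases "legal_moves G U C = {}")
    case True
    have "maximal_class G U C C"
      by (rule maximal_class_self) (use True less.prems in auto)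
    from less.prems(9)[OF this] have
      "rel (rounds_to_go G p (X \<union> U) {}) (k + rounds_to_go G p U {})"
      using less.prems(3) by (simp add: Diff_triv)
    then show ?thesis
      using assms(1) True leg less.prems(1,2,4)
        rounds_to_go_round_end[of U G C p] rounds_to_go_round_end[of "X \<union> U" G C p] by auto
  next
    case False
    have "rel (rounds_to_go G (opponent p) (X \<union> U - {v}) (insert v C))
        (k + rounds_to_go G (opponent p) (U - {v}) (insert v C))" if "v \<in> legal_moves G U C" for v
    proof -
      have v: "v \<in> U" "independent_set G (insert v C)" "v \<notin> X" "v \<notin> C"
        using that less.prems by (auto simp: legal_moves_def)
      have card: "card (U - {v}) < card U"
        using v less.prems(1) by (meson card_Diff1_less)
      have "rel (rounds_to_go G (opponent p) (X \<union> (U - {v})) (insert v C))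
          (k + rounds_to_go G (opponent p) (U - {v}) (insert v C))"
      proof (rule less.hyps[OF card])
        fix S assume S: "maximal_class G (U - {v}) (insert v C) S"
        have vS: "v \<in> S" using S by (auto simp: maximal_class_def)
        have "finite (S - C)"
          using S less.prems(1) v
          by (auto simp: maximal_class_def intro: finite_subset[of _ U])
        then have "card (S - C) = Suc (card (S - insert v C))"
          using vS v(4) by (metis Diff_insert DiffI card_Suc_Diff1)
        moreover have "U - {v} - S = U - S" using vS by auto
        moreover have "maximal_class G U C S"
          using S v by (auto simp: maximal_class_def)
        ultimately show "rel (rounds_to_go G (turn (opponent p) (card (S - insert v C)))
              (X \<union> (U - {v} - S)) {})
            (k + rounds_to_go G (turn (opponent p) (card (S - insert v C))) (U - {v} - S) {})"
          using less.prems(9)[of S] by (simp add: turn_Suc)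
      qed (use less.prems v in auto)
      moreover have "X \<union> U - {v} = X \<union> (U - {v})" using v by auto
      ultimately show ?thesis by simp
    qed
    then show ?thesis
      using False leg less.prems(1,4)
      by (simp add: rounds_to_go_step best_shift_rel[OF assms(1)] finite_legal_moves)
  qed
qed

section \<open>Play on the two sides of a join\<close>

definition joined :: "'a graph \<Rightarrow> 'a set \<Rightarrow> 'a set \<Rightarrow> bool" where
  "joined G X W \<longleftrightarrow> X \<inter> W = {} \<and> (\<forall>x\<in>X. \<forall>w\<in>W. {x, w} \<in> edges G)"

lemma joined_mono: "joined G X W \<Longrightarrow> X' \<subseteq> X \<Longrightarrow> W' \<subseteq> W \<Longrightarrow> joined G X' W'"
  unfolding joined_def by blast

text \<open>A round stays on the side of the join on which it was opened.\<close>

lemma maximal_class_joined: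
  assumes "maximal_class G U C S" "joined G X W" "v \<in> C" "v \<in> X"
  shows "S \<inter> W = {}"
  using assms maximal_classD(1,3)[OF assms(1)] unfolding joined_def by blast

lemma maximal_class_joined':
  assumes "maximal_class G U C S" "joined G X W" "v \<in> C" "v \<in> W"
  shows "S \<inter> X = {}"
  using assms maximal_classD(1,3)[OF assms(1)] unfolding joined_def by blast

text \<open>A round with class \<open>S\<close> inside \<open>W\<close> takes \<open>card S\<close>
  moves and removes \<open>card S\<close> vertices. The turn and the parity of \<open>W\<close>
  change together, so whether they agree is an invariant.\<close>

lemma turn_parity:
  assumes "finite W" "v \<in> W" "maximal_class G (W - {v}) {v} S"
  shows "(turn (opponent p) (card (S - {v})) = Alice \<longleftrightarrow> even (card (W - {v} - S))) \<longleftrightarrow>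
    (p = Alice \<longleftrightarrow> even (card W))"
proof -
  have S: "v \<in> S" "S \<subseteq> W" using assms(2,3) by (auto simp: maximal_class_def)
  have fS: "finite S" using S(2) assms(1) finite_subset by blast
  have "card W = card S + card (W - S)"
    using card_Diff_subset[OF fS S(2)] card_mono[OF assms(1) S(2)] by simp
  moreover have "card S = Suc (card (S - {v}))"
    using S(1) fS by (metis card_Suc_Diff1)
  moreover have "W - {v} - S = W - S" using S by auto
  ultimately have "card W = Suc (card (S - {v}) + card (W - {v} - S))" by simp
  then show ?thesis by (cases p) (auto simp: turn_def)
qed

text \<open>The induction step common to the upper and the lower bound: after a first move in
  \<open>W\<close>, the comparison is needed only at the start of the next round, for a smaller
  \<open>W'\<close> with the same parity invariant.\<close>

lemma join_first_move:
  assumes "rel = (\<le>) \<or> rel = (\<ge>)" "finite X" "finite W" "joined G X W" "v \<in> W"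
    and "\<And>W' q. W' \<subset> W \<Longrightarrow>
      (q = Alice \<longleftrightarrow> even (card W')) \<longleftrightarrow> (p = Alice \<longleftrightarrow> even (card W)) \<Longrightarrow>
      rel (rounds_to_go G q (X \<union> W') {}) (k + rounds_to_go G q W' {})"
  shows "rel (rounds_to_go G (opponent p) (X \<union> W - {v}) {v})
    (k + rounds_to_go G (opponent p) (W - {v}) {v})"
proof -
  have "X \<union> W - {v} = X \<union> (W - {v})" using assms(4,5) by (auto simp: joined_def)
  moreover have "rel (rounds_to_go G (opponent p) (X \<union> (W - {v})) {v})
    (k + rounds_to_go G (opponent p) (W - {v}) {v})"
  proof (rule join_round[OF assms(1)])
    fix S assume S: "maximal_class G (W - {v}) {v} S"
    have "W - {v} - S \<subset> W" using assms(5) by auto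
    then show "rel (rounds_to_go G (turn (opponent p) (card (S - {v}))) (X \<union> (W - {v} - S)) {})
      (k + rounds_to_go G (turn (opponent p) (card (S - {v}))) (W - {v} - S) {})"
      using assms(6) turn_parity[OF assms(3,5) S] by blast
  qed (use assms(2-5) in \<open>auto simp: joined_def\<close>)
  ultimately show ?thesis by simp
qed

text \<open>Alice plays optimally on \<open>W\<close> and answers in \<open>X\<close> when Bob starts a round there. She has to
  start a round in \<open>X\<close> herself only when \<open>W\<close> is used up; whether this happens is decided by the
  parity of \<open>W\<close>, since every round on \<open>W\<close> preserves
  \<open>p = Alice \<longleftrightarrow> even (card W)\<close>.\<close>

lemma join_le:
  assumes "finite X" "finite W" "joined G X W"
    and "\<And>W' v. W' \<subseteq> W \<Longrightarrow> v \<in> X \<Longrightarrow>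
      rounds_to_go G Alice (X \<union> W' - {v}) {v} \<le> k + rounds_to_go G Bob W' {}"
    and "(p = Alice \<longleftrightarrow> even (card W)) \<Longrightarrow> rounds_to_go G Alice X {} \<le> k"
  shows "rounds_to_go G p (X \<union> W) {} \<le> k + rounds_to_go G p W {}"
  using assms(2-)
proof (induction "card W" arbitrary: W p rule: less_induct)
  case less
  have first: "rounds_to_go G (opponent p) (X \<union> W - {v}) {v} \<le>
      k + rounds_to_go G (opponent p) (W - {v}) {v}" if v: "v \<in> W" for v
  proof (rule join_first_move[where rel = "(\<le>)"])
    fix W' q
    assume W': "W' \<subset> W"
      and q: "(q = Alice \<longleftrightarrow> even (card W')) \<longleftrightarrow> (p = Alice \<longleftrightarrow> even (card W))"
    show "rounds_to_go G q (X \<union> W') {} \<le> k + rounds_to_go G q W' {}"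
    proof (rule less.hyps)
      show "card W' < card W" using W' less.prems(1) by (simp add: psubset_card_mono)
      show "finite W'" using W' less.prems(1) finite_subset by blast
      show "joined G X W'" using W' less.prems(2) joined_mono by blast
    qed (use W' q less.prems in auto)
  qed (use less.prems assms(1) v in auto)
  show ?case
  proof (cases p)
    case Alice
    show ?thesis
    proof (cases "W = {}")
      case True
      \<comment> \<open>Here Alice must open in \<open>X\<close>. The empty \<open>W\<close> is
        even, so the conditional hypothesis on \<open>X\<close> alone applies.\<close>
      then show ?thesis using less.prems(4) Alice by simp
    next
      case False
      obtain v where v: "v \<in> W" "rounds_to_go G p W {} = rounds_to_go G (opponent p) (W - {v}) {v}"
        using optimal_move[of W G "{}" p] less.prems(1) False by auto
      have "rounds_to_go G Alice (X \<union> W) {} \<le> rounds_to_go G Bob (X \<union> W - {v}) {v}"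
        using Alice_move[of "X \<union> W" v G "{}"] v(1) assms(1) less.prems(1) by simp
      then show ?thesis using first[OF v(1)] v(2) Alice by simp
    qed
  next
    case Bob
    show ?thesis
    proof (cases "X \<union> W = {}")
      case False
      have "rounds_to_go G Alice (X \<union> W - {v}) {v} \<le> k + rounds_to_go G Bob W {}"
        if "v \<in> X \<union> W" for v
      proof (cases "v \<in> W")
        case True
        have "rounds_to_go G Alice (W - {v}) {v} \<le> rounds_to_go G Bob W {}"
          using Bob_move[of W v G "{}"] True less.prems(1) by simp
        then show ?thesis using first[OF True] Bob by simp
      next
        case False
        then show ?thesis using that less.prems(3)[of W v] by simp
      qed
      then show ?thesis
        using Bob False Bob_all_moves[of "X \<union> W" G "{}"] assms(1) less.prems(1) by simp
    qed simp
  qed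
qed

text \<open>Vertices of \<open>I\<close> do not block each other and block everything in
  \<open>W\<close>, so opening in \<open>I\<close> fixes the class of the round.\<close>

lemma maximal_class_independent_joined:
  assumes "maximal_class G U C S" "joined G I W" "independent_set G I" "U \<union> C = I \<union> W"
    and "v \<in> C" "v \<in> I"
  shows "S = I"
proof -
  have SI: "S \<subseteq> I"
    using maximal_class_joined[OF assms(1,2,5,6)] maximal_classD(2)[OF assms(1)] assms(4) by auto
  have "u \<in> S" if u: "u \<in> I" for u
  proof (rule ccontr)
    assume nS: "u \<notin> S"
    then have "u \<in> U" using u maximal_classD(1)[OF assms(1)] assms(4) by auto
    moreover have "{u, s} \<notin> edges G" if "s \<in> S" for s
      using independent_setD[OF assms(3) u, of s] SI that nS by auto
    ultimately show False using maximal_classD(4)[OF assms(1)] nS by metis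
  qed
  then show ?thesis using SI by auto
qed

text \<open>A round opened in \<open>I\<close> colors precisely \<open>I\<close>. As
  \<open>card I\<close> is even, Bob has to open again after such a round, so \<open>I\<close> costs
  one round and does not change the play on \<open>W\<close>.\<close>

lemma independent_join_le:
  assumes "finite I" "finite W" "joined G I W" "independent_set G I" "even (card I)"
    and "\<And>v. {v} \<notin> edges G"
  shows "rounds_to_go G p (I \<union> W) {} \<le> 1 + rounds_to_go G p W {}"
proof (rule join_le[OF assms(1-3)])
  fix W' v assume W': "W' \<subseteq> W" and v: "v \<in> I"
  have fin: "finite W'" using W' assms(2) finite_subset by blast
  have "rounds_to_go G Alice (I \<union> W' - {v}) {v} \<le> Suc (rounds_to_go G Bob W' {})"
  proof (rule round_le)
    fix S assume S: "maximal_class G (I \<union> W' - {v}) {v} S"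
    have disj: "S \<inter> W' = {}"
      using maximal_class_joined[OF S assms(3), of v] v W' by blast
    have "S = I"
      by (rule maximal_class_independent_joined[OF S joined_mono[OF assms(3) order_refl W'] assms(4)])
        (use v in auto)
    \<comment> \<open>Bob's \<open>v\<close> is already colored; after an odd number of further
      moves begun by Alice, Bob opens the next round.\<close>
    then have "odd (card (S - {v}))" using v assms(1,5) by auto
    moreover have "I \<union> W' - {v} - S = W'" using \<open>S = I\<close> disj v by auto
    ultimately show "rounds_to_go G (turn Alice (card (S - {v}))) (I \<union> W' - {v} - S) {}
        \<le> rounds_to_go G Bob W' {}"
      by (simp add: turn_def)
  qed (use assms(1) fin in auto)
  then show "rounds_to_go G Alice (I \<union> W' - {v}) {v} \<le> 1 + rounds_to_go G Bob W' {}" by simp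
qed (rule independent_le_1[OF assms(1,4,6)])

section \<open>Crown graphs\<close>

text \<open>\<open>crown G J\<close>: the pairs \<open>{2 * i, 2 * i + 1}\<close> with \<open>i \<in> J\<close> induce in \<open>G\<close> the complete bipartite
  graph between the even and the odd vertices minus the perfect matching formed by the pairs.\<close>

definition pairs :: "nat set \<Rightarrow> nat set" where
  "pairs J = {v. v div 2 \<in> J}"

text \<open>The partner of \<open>v\<close> in the removed perfect matching, hence its only
  non-neighbor on the opposite side of the crown.\<close>

definition mate :: "nat \<Rightarrow> nat" where
  "mate v = (if even v then Suc v else v - 1)"

definition crown :: "nat graph \<Rightarrow> nat set \<Rightarrow> bool" where
  "crown G J \<longleftrightarrow> (\<forall>u\<in>pairs J. \<forall>v\<in>pairs J.
    {u, v} \<in> edges G \<longleftrightarrow> even u \<noteq> even v \<and> u div 2 \<noteq> v div 2)"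

lemma crown_edge:
  "crown G J \<Longrightarrow> u \<in> pairs J \<Longrightarrow> v \<in> pairs J \<Longrightarrow>
    {u, v} \<in> edges G \<longleftrightarrow> even u \<noteq> even v \<and> u div 2 \<noteq> v div 2"
  by (simp add: crown_def)

lemma crown_mono: "crown G J \<Longrightarrow> J' \<subseteq> J \<Longrightarrow> crown G J'"
  unfolding crown_def pairs_def by blast

lemma pairs_mono: "J' \<subseteq> J \<Longrightarrow> pairs J' \<subseteq> pairs J"
  by (auto simp: pairs_def)

lemma mate_div2 [simp]: "mate v div 2 = v div 2"
  by (auto simp: mate_def elim!: oddE)

lemma even_mate [simp]: "even (mate v) \<longleftrightarrow> odd v"
  by (auto simp: mate_def)

lemma mate_neq [simp]: "mate v \<noteq> v" "v \<noteq> mate v"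
  by (auto simp: mate_def elim: oddE)

lemma mate_in_pairs [simp]: "mate v \<in> pairs J \<longleftrightarrow> v \<in> pairs J"
  by (simp add: pairs_def)

lemma eq_if_div2: "u div 2 = v div 2 \<Longrightarrow> even u = even v \<Longrightarrow> u = (v :: nat)"
  by presburger

lemma div2_eq_iff: "u div 2 = v div 2 \<longleftrightarrow> u = v \<or> u = mate v"
  using eq_if_div2[of u v] eq_if_div2[of u "mate v"] by auto

text \<open>Coloring a vertex together with its mate leaves a crown with one pair fewer.\<close>

lemma pairs_remove: "pairs J - {v, mate v} = pairs (J - {v div 2})"
  by (auto simp: pairs_def div2_eq_iff)

lemma side_eq: "{u \<in> pairs J. even u = b} = (\<lambda>i. 2 * i + (if b then 0 else 1)) ` J"
  by (cases b) (auto simp: pairs_def intro: rev_image_eqI)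

lemma card_side: "card {u \<in> pairs J. even u = b} = card J"
  unfolding side_eq by (intro card_image) (auto simp: inj_on_def)

lemma finite_pairs:
  assumes "finite J"
  shows "finite (pairs J)"
proof (rule finite_subset)
  show "pairs J \<subseteq> {u \<in> pairs J. even u = True} \<union> {u \<in> pairs J. even u = False}" by auto
  have "finite {u \<in> pairs J. even u = b}" for b unfolding side_eq using assms by simp
  then show "finite ({u \<in> pairs J. even u = True} \<union> {u \<in> pairs J. even u = False})" by blast
qed

section \<open>Color classes in a crown\<close>

lemma independent_side: "crown G J \<Longrightarrow> independent_set G {u \<in> pairs J. even u = b}"
  by (auto simp: independent_set_iff crown_edge)

text \<open>Any vertex of another pair lies opposite to \<open>v\<close> or to \<open>mate v\<close>
  and is adjacent to it, so the pair already blocks the rest of the crown.\<close>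

lemma maximal_class_pair:
  assumes "crown G J" "maximal_class G U C S" "v \<in> pairs J" "v \<in> S" "mate v \<in> S"
  shows "S \<inter> pairs J = {v, mate v}"
proof -
  have "u = v \<or> u = mate v" if u: "u \<in> S" "u \<in> pairs J" for u
  proof (rule ccontr)
    assume "\<not> (u = v \<or> u = mate v)"
    then have neq: "u div 2 \<noteq> v div 2" "u \<noteq> v" "u \<noteq> mate v" by (auto simp: div2_eq_iff)
    have "{u, v} \<notin> edges G" "{u, mate v} \<notin> edges G"
      using maximal_classD(3)[OF assms(2) u(1)] assms(4,5) neq by auto
    then show False using crown_edge[OF assms(1) u(2)] assms(3) neq by auto
  qed
  then show ?thesis using assms(3-5) by auto
qed

text \<open>A vertex of the opposite side has only one non-neighbor on this side, so it cannot join
  two vertices of this side.\<close>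

lemma maximal_class_side:
  assumes "crown G J" "maximal_class G U C S" "x \<in> pairs J" "y \<in> pairs J"
    and "x \<in> S" "y \<in> S" "x \<noteq> y" "even x = even y"
  shows "S \<inter> pairs J \<subseteq> {u \<in> pairs J. even u = even x}"
proof -
  have "even u = even x" if u: "u \<in> S" "u \<in> pairs J" for u
  proof (rule ccontr)
    assume ne: "even u \<noteq> even x"
    have "{u, x} \<notin> edges G" "{u, y} \<notin> edges G"
      using maximal_classD(3)[OF assms(2) u(1)] assms(5-8) ne by auto
    then have "u div 2 = x div 2" "u div 2 = y div 2"
      using crown_edge[OF assms(1) u(2)] assms(3,4,8) ne by auto
    then show False using assms(7,8) eq_if_div2 by metis
  qed
  then show ?thesis by auto
qed

lemma other_on_side:
  assumes "v \<in> pairs J" "2 \<le> card J"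
  obtains y where "y \<in> pairs J" "y \<noteq> v" "even y = even v"
proof -
  have "{u \<in> pairs J. even u = even v} \<noteq> {v}"
    using card_side[of J "even v"] assms(2) by (metis One_nat_def card.empty card_insert_disjoint
        empty_iff finite.emptyI not_less_eq_eq numeral_2_eq_2 order_refl)
  then show ?thesis using that assms(1) by auto
qed

text \<open>Every class contains \<open>T\<close>. On the crown it is either a pair, and induction
  applies, or a full side, and an independent set remains. The maximum with 1 is needed because
  crowns with at most one pair have no edges.\<close>

lemma crown_isolated_le:
  assumes "crown G J" "finite J" "finite T" "\<And>v. {v} \<notin> edges G"
    and "\<And>t u. t \<in> T \<Longrightarrow> u \<in> pairs J \<union> T \<Longrightarrow> {t, u} \<notin> edges G"
  shows "rounds_to_go G p (pairs J \<union> T) {} \<le> max 1 (card J)"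
  using assms
proof (induction "card J" arbitrary: p J T rule: less_induct)
  case less
  have fin: "finite (pairs J \<union> T)" using less.prems finite_pairs by simp
  show ?case
  proof (cases "card J \<le> 1")
    case True
    then have one: "i = j" if "i \<in> J" "j \<in> J" for i j
      using that card_le_Suc0_iff_eq[OF less.prems(2)] by auto
    have "{u, v} \<notin> edges G" if u: "u \<in> pairs J \<union> T" and v: "v \<in> pairs J \<union> T" for u v
    proof (cases "u \<in> T \<or> v \<in> T")
      case True
      then show ?thesis using less.prems(5)[of u v] less.prems(5)[of v u] u v
        by (auto simp: insert_commute)
    next
      case False
      then have "u \<in> pairs J" "v \<in> pairs J" using u v by auto
      then show ?thesis
        using crown_edge[OF less.prems(1)] one[of "u div 2" "v div 2"] by (simp add: pairs_def)
    qed
    then have "independent_set G (pairs J \<union> T)" by (simp add: independent_set_iff)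
    then show ?thesis using independent_le_1[OF fin _ less.prems(4), of p] by simp
  next
    case False
    have "rounds_to_go G p (pairs J \<union> T) {} \<le> Suc (card J - 1)"
    proof (rule round_le)
      fix S assume S: "maximal_class G (pairs J \<union> T) {} S"
      let ?q = "turn p (card (S - {}))"
      have TS: "T \<subseteq> S"
      proof
        fix t assume t: "t \<in> T"
        then show "t \<in> S"
          using maximal_classD(4)[OF S, of t] maximal_classD(2)[OF S] less.prems(5)[OF t] by auto
      qed
      show "rounds_to_go G ?q (pairs J \<union> T - S) {} \<le> card J - 1"
      proof (cases "\<exists>v\<in>S \<inter> pairs J. mate v \<in> S")
        case True
        then obtain v where v: "v \<in> S" "v \<in> pairs J" "mate v \<in> S" by auto
        have vJ: "v div 2 \<in> J" using v(2) by (simp add: pairs_def)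
        have "pairs J \<union> T - S = pairs J - {v, mate v}"
          using maximal_class_pair[OF less.prems(1) S v(2,1,3)] TS by auto
        \<comment> \<open>The isolated vertices are used up in the first round, so the induction
          continues with an empty \<open>T\<close>.\<close>
        then have eq: "pairs J \<union> T - S = pairs (J - {v div 2}) \<union> {}"
          by (simp add: pairs_remove)
        have "rounds_to_go G ?q (pairs (J - {v div 2}) \<union> {}) {} \<le> max 1 (card (J - {v div 2}))"
        proof (rule less.hyps)
          show "card (J - {v div 2}) < card J" using vJ less.prems(2) by (meson card_Diff1_less)
        qed (use less.prems crown_mono[OF less.prems(1)] in auto)
        then show ?thesis using eq vJ False less.prems(2) by simp
      next
        case nopair: False
        have same: "even u = even v" if uv: "u \<in> S \<inter> pairs J" "v \<in> S \<inter> pairs J" for u v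
        proof (rule ccontr)
          assume ne: "even u \<noteq> even v"
          then have "{u, v} \<notin> edges G" using maximal_classD(3)[OF S] uv by auto
          then have "u div 2 = v div 2" using crown_edge[OF less.prems(1)] uv ne by auto
          then show False using ne uv nopair by (auto simp: div2_eq_iff)
        qed
        \<comment> \<open>The side that contains the class. If the class missed the crown,
          \<open>b\<close> would be \<open>False\<close>, and the argument below would still put the
          odd side into \<open>S\<close>.\<close>
        define b where "b = (\<exists>v\<in>S \<inter> pairs J. even v)"
        have b: "even u = b" if "u \<in> S \<inter> pairs J" for u
          unfolding b_def using that same by metis
        have "u \<in> S" if u: "u \<in> pairs J" "even u = b" for u
        proof (rule maximal_classD(4)[OF S])
          show "u \<in> pairs J \<union> T" using u by simp
          fix s assume s: "s \<in> S"
          show "{u, s} \<notin> edges G"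
          proof (cases "s \<in> pairs J")
            case True
            then show ?thesis using b[of s] s u crown_edge[OF less.prems(1) u(1)] by auto
          next
            case False
            then have "s \<in> T" using s maximal_classD(2)[OF S] by auto
            then show ?thesis using less.prems(5)[of s u] u by (simp add: insert_commute)
          qed
        qed
        then have "pairs J \<union> T - S \<subseteq> {u \<in> pairs J. even u = (\<not> b)}" using TS by auto
        then have "independent_set G (pairs J \<union> T - S)"
          by (rule independent_set_mono[OF independent_side[OF less.prems(1)]])
        then have "rounds_to_go G ?q (pairs J \<union> T - S) {} \<le> 1"
          by (intro independent_le_1) (use fin less.prems(4) in auto)
        then show ?thesis using False by simp
      qed
    qed (use fin False side_eq[of J True] card_side[of J True] in auto)
    then show ?thesis using False by simp
  qed
qed

text \<open>When Bob opens in the crown, Alice answers on the same side: the round uses up this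
  side, Bob opens again, and the other side is an independent set of even size that costs one more
  round. Hence \<open>k = 2\<close> is enough unless the parity can force Alice to open in the
  crown; then \<open>card J\<close> rounds are allowed.\<close>

lemma crown_join_le:
  assumes "crown G J" "finite J" "even (card J)" "J \<noteq> {}" "finite W" "joined G (pairs J) W"
    and "\<And>v. {v} \<notin> edges G" "2 \<le> k" "(p = Alice \<longleftrightarrow> even (card W)) \<Longrightarrow> card J \<le> k"
  shows "rounds_to_go G p (pairs J \<union> W) {} \<le> k + rounds_to_go G p W {}"
proof (rule join_le[OF finite_pairs[OF assms(2)] assms(5,6)])
  have two: "2 \<le> card J"
    using assms(2-4) by (metis card_0_eq even_zero not_less_eq_eq One_nat_def le_Suc_eq le_zero_eq
        numeral_2_eq_2 odd_one)
  show "rounds_to_go G Alice (pairs J) {} \<le> k" if "p = Alice \<longleftrightarrow> even (card W)"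
    using crown_isolated_le[OF assms(1,2) _ assms(7), of "{}" Alice] assms(8,9) that by auto
  fix W' v assume W': "W' \<subseteq> W" and v: "v \<in> pairs J"
  have fin: "finite W'" "finite (pairs J)" using W' assms(2,5) finite_subset finite_pairs by blast+
  have J': "joined G (pairs J) W'" using joined_mono[OF assms(6)] W' by blast
  then have disj: "pairs J \<inter> W' = {}" by (simp add: joined_def)
  obtain y where y: "y \<in> pairs J" "y \<noteq> v" "even y = even v" using other_on_side[OF v two] .
  let ?U = "pairs J \<union> W' - {v} - {y}"
  let ?side = "\<lambda>b. {u \<in> pairs J. even u = b}"
  have ind: "independent_set G {y, v}"
    using crown_edge[OF assms(1)] v y by (auto simp: independent_set_iff)
  have "rounds_to_go G Bob ?U {y, v} \<le> Suc (1 + rounds_to_go G Bob W' {})"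
  proof (rule round_le)
    fix S assume S: "maximal_class G ?U {y, v} S"
    have CS: "y \<in> S" "v \<in> S" using maximal_classD(1)[OF S] by auto
    have SW: "S \<inter> W' = {}" using maximal_class_joined[OF S J', of v] v by simp
    then have SJ: "S \<subseteq> pairs J" using maximal_classD(2)[OF S] v y by auto
    then have "S \<subseteq> ?side (even v)"
      using maximal_class_side[OF assms(1) S v y(1) CS(2,1)] y by auto
    moreover have "u \<in> S" if u: "u \<in> pairs J" "even u = even v" for u
    proof (cases "u \<in> {y, v}")
      case False
      show ?thesis
        by (rule maximal_classD(4)[OF S])
          (use u False \<open>S \<subseteq> ?side (even v)\<close> crown_edge[OF assms(1) u(1)] in auto)
    qed (use CS in auto)
    ultimately have Seq: "S = ?side (even v)" by auto
    have "card (S - {y, v}) = card S - 2"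
      using CS y(2) fin(2) finite_subset[OF SJ] by (simp add: card_Diff_subset)
    \<comment> \<open>The side has even size and two of its vertices are colored, so Bob, who is on
      move, also opens the next round.\<close>
    then have ev: "even (card (S - {y, v}))" using card_side[of J "even v"] assms(3) Seq by simp
    have "?U - S = ?side (\<not> even v) \<union> W'" using Seq disj v y by auto
    moreover have "rounds_to_go G Bob (?side (\<not> even v) \<union> W') {} \<le> 1 + rounds_to_go G Bob W' {}"
    proof (rule independent_join_le)
      show "joined G (?side (\<not> even v)) W'" using joined_mono[OF J'] by auto
      show "even (card (?side (\<not> even v)))" using assms(3) by (simp only: card_side)
    qed (use fin independent_side[OF assms(1)] assms(7) in auto)
    ultimately show "rounds_to_go G (turn Bob (card (S - {y, v}))) (?U - S) {}
        \<le> 1 + rounds_to_go G Bob W' {}"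
      using ev by (simp add: turn_def)
  qed (use fin ind in auto)
  moreover have "rounds_to_go G Alice (pairs J \<union> W' - {v}) {v} \<le> rounds_to_go G Bob ?U {y, v}"
    by (rule Alice_move) (use fin y ind in \<open>auto simp: legal_moves_def\<close>)
  ultimately show "rounds_to_go G Alice (pairs J \<union> W' - {v}) {v} \<le> k + rounds_to_go G Bob W' {}"
    using assms(8) by linarith
qed

text \<open>Bob answers a move in the crown by the mate of the vertex, which ends the round there, so the
  crown lasts for \<open>card J\<close> rounds.\<close>

lemma crown_join_ge:
  assumes "crown G J" "finite J" "finite W" "joined G (pairs J) W"
    and "p = Alice \<longleftrightarrow> even (card W)"
  shows "card J + rounds_to_go G p W {} \<le> rounds_to_go G p (pairs J \<union> W) {}"
  using assms
proof (induction "card J + card W" arbitrary: J W p rule: less_induct)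
  case less
  have fin: "finite (pairs J)" using less.prems(2) finite_pairs by blast
  have disj: "pairs J \<inter> W = {}" using less.prems(4) by (simp add: joined_def)
  have first: "card J + rounds_to_go G (opponent p) (W - {v}) {v} \<le>
      rounds_to_go G (opponent p) (pairs J \<union> W - {v}) {v}" if v: "v \<in> W" for v
  proof (rule join_first_move[where rel = "(\<ge>)"])
    fix W' q
    assume W': "W' \<subset> W"
      and q: "(q = Alice \<longleftrightarrow> even (card W')) \<longleftrightarrow> (p = Alice \<longleftrightarrow> even (card W))"
    show "card J + rounds_to_go G q W' {} \<le> rounds_to_go G q (pairs J \<union> W') {}"
    proof (rule less.hyps)
      show "card J + card W' < card J + card W"
        using W' less.prems(3) by (simp add: psubset_card_mono)
      show "finite W'" using W' less.prems(3) finite_subset by blast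
      show "joined G (pairs J) W'" using W' less.prems(4) joined_mono by blast
    qed (use q less.prems in auto)
  qed (use less.prems fin v in auto)
  show ?case
  proof (cases p)
    case Bob
    \<comment> \<open>With Bob on move \<open>W\<close> is odd, so he never has to open in the crown
      and can play optimally on \<open>W\<close>.\<close>
    then have "W \<noteq> {}" using less.prems(5) by auto
    then obtain v where v: "v \<in> W" "rounds_to_go G p W {} = rounds_to_go G (opponent p) (W - {v}) {v}"
      using optimal_move[of W G "{}" p] less.prems(3) by auto
    have "rounds_to_go G Alice (pairs J \<union> W - {v}) {v} \<le> rounds_to_go G Bob (pairs J \<union> W) {}"
      using Bob_move[of "pairs J \<union> W" v G "{}"] v(1) fin less.prems(3) by simp
    then show ?thesis using first[OF v(1)] v(2) Bob by simp
  next
    case Alice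
    show ?thesis
    proof (cases "pairs J \<union> W = {}")
      case True
      then show ?thesis using card_side[of J True] by simp
    next
      case False
      have "card J + rounds_to_go G Alice W {} \<le> rounds_to_go G Bob (pairs J \<union> W - {v}) {v}"
        if "v \<in> pairs J \<union> W" for v
      proof (cases "v \<in> W")
        case True
        have "rounds_to_go G Alice W {} \<le> rounds_to_go G Bob (W - {v}) {v}"
          using Alice_move[of W v G "{}"] True less.prems(3) by simp
        then show ?thesis using first[OF True] Alice by simp
      next
        case False
        then have v: "v \<in> pairs J" using that by simp
        then have vJ: "v div 2 \<in> J" by (simp add: pairs_def)
        have mW: "v \<notin> W" "mate v \<notin> W" using v disj mate_in_pairs[of v J] by blast+
        let ?U = "pairs J \<union> W - {v} - {mate v}"
        have ind: "independent_set G {mate v, v}"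
          using crown_edge[OF less.prems(1)] v by (auto simp: independent_set_iff)
        \<comment> \<open>The pair completes the round, so Alice opens again, with one pair fewer
          and an unchanged \<open>W\<close>.\<close>
        have "Suc (card J - 1 + rounds_to_go G Alice W {}) \<le> rounds_to_go G Alice ?U {mate v, v}"
        proof (rule round_ge)
          fix S assume S: "maximal_class G ?U {mate v, v} S"
          have "S \<inter> W = {}" using maximal_class_joined[OF S less.prems(4), of v] v by simp
          moreover have "S \<inter> pairs J = {v, mate v}"
            using maximal_class_pair[OF less.prems(1) S v] maximal_classD(1)[OF S] by simp
          ultimately have Seq: "S = {v, mate v}"
            using maximal_classD(2)[OF S] v by auto
          have "?U - S = (pairs J - {v, mate v}) \<union> W"
            using Seq mW by auto
          then have "?U - S = pairs (J - {v div 2}) \<union> W" by (simp only: pairs_remove)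
          moreover have "card (J - {v div 2}) + rounds_to_go G Alice W {} \<le>
              rounds_to_go G Alice (pairs (J - {v div 2}) \<union> W) {}"
          proof (rule less.hyps)
            show "card (J - {v div 2}) + card W < card J + card W"
              using vJ less.prems(2) by (simp add: card_Diff1_less del: card_Diff_insert)
            show "crown G (J - {v div 2})" using crown_mono[OF less.prems(1)] by auto
            show "joined G (pairs (J - {v div 2})) W"
              using joined_mono[OF less.prems(4)] pairs_mono[of "J - {v div 2}" J] by auto
          qed (use less.prems Alice in auto)
          moreover have "turn Alice (card (S - {mate v, v})) = Alice"
            by (simp add: Seq insert_commute)
          ultimately show "card J - 1 + rounds_to_go G Alice W {} \<le>
              rounds_to_go G (turn Alice (card (S - {mate v, v}))) (?U - S) {}"
            using vJ less.prems(2) by simp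
        qed (use fin less.prems(3) ind in auto)
        moreover have "rounds_to_go G Alice ?U {mate v, v} \<le> rounds_to_go G Bob (pairs J \<union> W - {v}) {v}"
          by (rule Bob_move)
            (use fin less.prems(3) v ind in \<open>auto simp: legal_moves_def\<close>)
        moreover have "0 < card J" using vJ less.prems(2) by (auto simp: card_gt_0_iff)
        ultimately show ?thesis by linarith
      qed
      then show ?thesis
        using Alice False Alice_all_moves[of "pairs J \<union> W" G "{}"] fin less.prems(3) by simp
    qed
  qed
qed

section \<open>Lower bounds from cliques\<close>

lemma crown_edge_in:
  assumes "crown G J" "2 \<le> card J"
  obtains u v where "u \<in> pairs J" "v \<in> pairs J" "u \<noteq> v" "{u, v} \<in> edges G"
proof -
  have "J \<noteq> {}" using assms(2) by auto
  then obtain u where u: "u \<in> pairs J"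
    by (auto simp: pairs_def) (metis div_mult_self1_is_m zero_less_numeral)
  obtain y where y: "y \<in> pairs J" "y \<noteq> u" "even y = even u" using other_on_side[OF u assms(2)] .
  have "u div 2 \<noteq> y div 2" using y eq_if_div2 by metis
  then have "{u, mate y} \<in> edges G" using crown_edge[OF assms(1) u, of "mate y"] y by simp
  moreover have "u \<noteq> mate y" using y(3) by (metis even_mate)
  ultimately show ?thesis using that[of u "mate y"] u y by simp
qed

lemma two_le_crown:
  assumes "crown G J" "2 \<le> card J" "pairs J \<subseteq> U" "finite U"
  shows "2 \<le> rounds_to_go G p U {}"
proof -
  obtain u v where uv: "u \<in> pairs J" "v \<in> pairs J" "u \<noteq> v" "{u, v} \<in> edges G"
    using crown_edge_in[OF assms(1,2)] .
  have "card {u, v} \<le> rounds_to_go G p U {}"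
    by (rule clique_le_rounds) (use uv assms in \<open>auto simp: insert_commute\<close>)
  then show ?thesis using uv by simp
qed

text \<open>An edge of each crown gives a clique on four vertices in the join.\<close>

lemma four_le_crown_join:
  assumes "crown G J" "2 \<le> card J" "crown G K" "2 \<le> card K"
    and "joined G (pairs K) (pairs J)" "pairs K \<union> pairs J \<subseteq> U" "finite U"
  shows "4 \<le> rounds_to_go G p U {}"
proof -
  obtain u v where uv: "u \<in> pairs J" "v \<in> pairs J" "u \<noteq> v" "{u, v} \<in> edges G"
    using crown_edge_in[OF assms(1,2)] .
  obtain w x where wx: "w \<in> pairs K" "x \<in> pairs K" "w \<noteq> x" "{w, x} \<in> edges G"
    using crown_edge_in[OF assms(3,4)] .
  have e: "{w, u} \<in> edges G" "{w, v} \<in> edges G" "{x, u} \<in> edges G" "{x, v} \<in> edges G"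
    using assms(5) uv wx by (auto simp: joined_def)
  have ne: "w \<notin> {u, v}" "x \<notin> {u, v}"
    using assms(5) uv wx by (auto simp: joined_def)
  have "card {w, x, u, v} \<le> rounds_to_go G p U {}"
  proof (rule clique_le_rounds)
    fix s t assume "s \<in> {w, x, u, v}" "t \<in> {w, x, u, v}" "s \<noteq> t"
    then show "{s, t} \<in> edges G" using e uv(4) wx(4) by (auto simp: insert_commute)
  qed (use uv wx assms in auto)
  then show ?thesis using ne uv(3) wx(3) by simp
qed

section \<open>A crown with an additional edge and an additional isolated vertex\<close>

text \<open>Only the edges of \<open>G\<close> among these vertices are described, so the results
  apply inside a larger graph. Two pairs are enough here because some arguments continue after a
  pair is removed. The roles of \<open>a\<close> and \<open>b\<close> are symmetric.\<close>

locale gadget =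
  fixes G :: "nat graph" and J :: "nat set" and a b c :: nat
  assumes crown_J: "crown G J" and finite_J: "finite J" and card_J: "2 \<le> card J"
    and no_loop: "\<And>v. {v} \<notin> edges G"
    and edge_ab: "{a, b} \<in> edges G" and nonedges: "{a, c} \<notin> edges G" "{b, c} \<notin> edges G"
    and abc: "a \<noteq> b" "a \<noteq> c" "b \<noteq> c" "a \<notin> pairs J" "b \<notin> pairs J" "c \<notin> pairs J"
    and isolated: "\<And>t u. t \<in> {a, b, c} \<Longrightarrow> u \<in> pairs J \<Longrightarrow> {t, u} \<notin> edges G"
begin

definition R :: "nat set" where
  "R = pairs J \<union> {a, b, c}"

lemma finite_R: "finite R"
  using finite_pairs[OF finite_J] by (simp add: R_def)

lemma swap: "gadget G J b a c"
  using gadget_axioms unfolding gadget_def by (auto simp: insert_commute)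

lemma remove_pair: "i \<in> J \<Longrightarrow> 3 \<le> card J \<Longrightarrow> gadget G (J - {i}) a b c"
  using gadget_axioms pairs_mono[of "J - {i}" J] crown_mono[of G J "J - {i}"]
  unfolding gadget_def by auto

lemma isolated': "t \<in> {a, b, c} \<Longrightarrow> u \<in> pairs J \<Longrightarrow> {u, t} \<notin> edges G"
  using isolated[of t u] by (simp add: insert_commute)

section \<open>Rounds confined to one side of the crown\<close>

lemma independent_insert_pairs:
  assumes "independent_set G C" "C \<subseteq> {a, b, c}" "independent_set G D" "D \<subseteq> pairs J"
  shows "independent_set G (D \<union> C)"
  unfolding independent_set_iff
proof (intro ballI impI)
  fix u v assume uv: "u \<in> D \<union> C" "v \<in> D \<union> C" "u \<noteq> v"
  then consider "u \<in> D" "v \<in> D" | "u \<in> C" "v \<in> C" | "u \<in> C" "v \<in> D" | "u \<in> D" "v \<in> C" by auto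
  then show "{u, v} \<notin> edges G"
    using independent_setD[OF assms(1), of u v] independent_setD[OF assms(3), of u v] uv(3)
      isolated[of u v] isolated'[of v u] assms(2,4) by cases auto
qed

lemma independent_insert_vertex:
  assumes "independent_set G C" "C \<subseteq> {a, b, c}" "u \<in> pairs J"
  shows "independent_set G (insert u C)"
  using independent_insert_pairs[OF assms(1,2), of "{u}"] assms(3) by simp

text \<open>By maximality the class contains the whole side \<open>x\<close>, and it cannot leave
  both \<open>a\<close> and \<open>b\<close> uncolored, since only \<open>b\<close> could block
  \<open>a\<close>. What remains lies in the other side plus one of \<open>a\<close>,
  \<open>b\<close> and possibly \<open>c\<close>.\<close>

lemma rest_independent:
  assumes "maximal_class G U C S" "U \<union> C \<subseteq> R" "S \<inter> pairs J \<subseteq> {u \<in> pairs J. even u = x}"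
    and "{u \<in> pairs J. even u = x} \<subseteq> U \<union> C"
  shows "independent_set G (U - S)"
proof -
  have SR: "S \<subseteq> R" using maximal_classD(2)[OF assms(1)] assms(2) by auto
  have side: "u \<in> S" if u: "u \<in> pairs J" "even u = x" for u
  proof (cases "u \<in> C")
    case True
    then show ?thesis using maximal_classD(1)[OF assms(1)] by auto
  next
    case False
    show ?thesis
    proof (rule maximal_classD(4)[OF assms(1)])
      show "u \<in> U" using u False assms(4) by auto
      fix s assume s: "s \<in> S"
      show "{u, s} \<notin> edges G"
      proof (cases "s \<in> pairs J")
        case True
        then have "even s = x" using s assms(3) by blast
        then show ?thesis using crown_edge[OF crown_J u(1) True] u(2) by simp
      next
        case False
        then have "s \<in> {a, b, c}" using s SR by (auto simp: R_def)
        then show ?thesis using isolated' u(1) by blast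
      qed
    qed
  qed
  have "\<not> (a \<in> U - S \<and> b \<in> U - S)"
  proof
    assume ab: "a \<in> U - S \<and> b \<in> U - S"
    have "a \<in> S"
    proof (rule maximal_classD(4)[OF assms(1)])
      show "a \<in> U" using ab by simp
      fix s assume s: "s \<in> S"
      then have "s \<in> pairs J \<or> s = a \<or> s = b \<or> s = c" using SR by (auto simp: R_def)
      then show "{a, s} \<notin> edges G" using isolated[of a s] no_loop[of a] nonedges ab s by auto
    qed
    then show False using ab by simp
  qed
  moreover have "U - S \<subseteq> {u \<in> pairs J. even u = (\<not> x)} \<union> {a, b, c}"
    using side assms(2) by (auto simp: R_def)
  ultimately have sub: "U - S \<subseteq> {u \<in> pairs J. even u = (\<not> x)} \<union> {a, c} \<or>
      U - S \<subseteq> {u \<in> pairs J. even u = (\<not> x)} \<union> {b, c}"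
    by auto
  have "independent_set G ({u \<in> pairs J. even u = (\<not> x)} \<union> {t, c})" if "t \<in> {a, b}" for t
  proof (rule independent_insert_pairs)
    show "independent_set G {t, c}"
      using nonedges that by (auto simp: independent_set_iff insert_commute)
  qed (use that independent_side[OF crown_J] in auto)
  from independent_set_mono[OF this[of a]] independent_set_mono[OF this[of b]]
  show ?thesis using sub by auto
qed

lemma two_rounds_one_side:
  assumes "U \<union> C \<subseteq> R" "U \<union> C \<noteq> {}" "U \<inter> C = {}" "independent_set G C"
    and "{u \<in> pairs J. even u = x} \<subseteq> U \<union> C"
    and "\<And>S. maximal_class G U C S \<Longrightarrow> S \<inter> pairs J \<subseteq> {u \<in> pairs J. even u = x}"
  shows "rounds_to_go G p U C \<le> 2"
proof (rule two_more_rounds)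
  show "finite U" using assms(1) finite_R finite_subset by blast
  show "independent_set G (U - S)" if "maximal_class G U C S" for S
    by (rule rest_independent[OF that assms(1) assms(6)[OF that] assms(5)])
qed (use assms no_loop in auto)

text \<open>Alice answers \<open>v\<close> by a second vertex of its side, which confines the round
  to that side; one further round finishes the independent rest.\<close>

lemma Alice_same_side:
  assumes "U \<subseteq> R" "pairs J \<subseteq> U" "C \<subseteq> {a, b, c}" "U \<inter> C = {}" "independent_set G C"
    and "v \<in> pairs J"
  shows "rounds_to_go G Alice (U - {v}) (insert v C) \<le> 2"
proof -
  obtain y where y: "y \<in> pairs J" "y \<noteq> v" "even y = even v"
    using other_on_side[OF assms(6) card_J] .
  have vC: "v \<notin> C" "y \<notin> C" using assms(2,4,6) y by auto
  have "{u \<in> pairs J. even u = even v} \<supseteq> {y, v}" using y assms(6) by auto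
  then have "independent_set G {y, v}"
    using independent_side[OF crown_J] independent_set_mono by blast
  then have ind: "independent_set G (insert y (insert v C))"
    using independent_insert_pairs[OF assms(5,3), of "{y, v}"] y assms(6) by simp
  have fin: "finite U" using assms(1) finite_R finite_subset by blast
  have "rounds_to_go G Alice (U - {v}) (insert v C) \<le>
      rounds_to_go G Bob (U - {v} - {y}) (insert y (insert v C))"
    by (rule Alice_move) (use fin y assms(2) ind in \<open>auto simp: legal_moves_def\<close>)
  also have "\<dots> \<le> 2"
  proof (rule two_rounds_one_side[where x = "even v"])
    show "U - {v} - {y} \<union> insert y (insert v C) \<subseteq> R"
      using assms y by (auto simp: R_def)
    fix S assume S: "maximal_class G (U - {v} - {y}) (insert y (insert v C)) S"
    show "S \<inter> pairs J \<subseteq> {u \<in> pairs J. even u = even v}"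
      by (rule maximal_class_side[OF crown_J S assms(6) y(1)])
        (use maximal_classD(1)[OF S] y in auto)
  qed (use assms ind in auto)
  finally show ?thesis .
qed

text \<open>Bob, with only crown vertices available, has to make the first move there and gives
  Alice the answer on the same side.\<close>

lemma Bob_enters_crown:
  assumes "U \<subseteq> R" "pairs J \<subseteq> U" "C \<subseteq> {a, b, c}" "U \<inter> C = {}" "independent_set G C"
    and "legal_moves G U C \<subseteq> pairs J"
  shows "rounds_to_go G Bob U C \<le> 2"
proof (rule Bob_all_moves)
  show "finite U" using assms(1) finite_R finite_subset by blast
  obtain u v where "u \<in> pairs J" "{u, v} \<in> edges G"
    using crown_edge_in[OF crown_J card_J] .
  then have "u \<in> legal_moves G U C"
    using independent_insert_vertex[OF assms(5,3)] assms(2) by (auto simp: legal_moves_def)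
  then show "legal_moves G U C \<noteq> {}" by auto
  show "rounds_to_go G Alice (U - {v}) (insert v C) \<le> 2" if "v \<in> legal_moves G U C" for v
    using Alice_same_side[OF assms(1-5)] that assms(6) by blast
qed

section \<open>Play on the gadget, complete or without one vertex\<close>

lemma R_minus_crown_vertex_le:
  assumes "x \<in> pairs J"
  shows "rounds_to_go G Alice (R - {x}) {} \<le> 2"
proof -
  \<comment> \<open>Alice opens with the mate of the deleted vertex. Its only non-neighbor on the
    opposite side is gone, so this single move confines the round to its side.\<close>
  have "rounds_to_go G Alice (R - {x}) {} \<le> rounds_to_go G Bob (R - {x} - {mate x}) {mate x}"
    using Alice_move[of "R - {x}" "mate x" G "{}"] finite_R assms by (simp add: R_def)
  also have "\<dots> \<le> 2"
  proof (rule two_rounds_one_side[where x = "even (mate x)"])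
    show "{u \<in> pairs J. even u = even (mate x)} \<subseteq> R - {x} - {mate x} \<union> {mate x}"
      by (auto simp: R_def)
    fix S assume S: "maximal_class G (R - {x} - {mate x}) {mate x} S"
    have "even u = even (mate x)" if u: "u \<in> S" "u \<in> pairs J" for u
    proof (rule ccontr)
      assume ne: "even u \<noteq> even (mate x)"
      then have "u \<noteq> mate x" by blast
      then have "{u, mate x} \<notin> edges G"
        using maximal_classD(3)[OF S u(1), of "mate x"] maximal_classD(1)[OF S] by simp
      then have "u = x \<or> u = mate x"
        using crown_edge[OF crown_J u(2), of "mate x"] ne assms by (simp add: div2_eq_iff)
      then show False using ne u(1) maximal_classD(2)[OF S] by auto
    qed
    then show "S \<inter> pairs J \<subseteq> {u \<in> pairs J. even u = even (mate x)}" by auto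
  qed (use assms in \<open>auto simp: R_def\<close>)
  finally show ?thesis .
qed

text \<open>Alice takes \<open>a\<close>, which blocks \<open>b\<close>; without \<open>c\<close>
  Bob has no move outside the crown.\<close>

lemma R_minus_c_le: "rounds_to_go G Alice (R - {c}) {} \<le> 2"
proof -
  have "rounds_to_go G Alice (R - {c}) {} \<le> rounds_to_go G Bob (R - {c} - {a}) {a}"
    using Alice_move[of "R - {c}" a G "{}"] finite_R abc by (simp add: R_def)
  also have "\<dots> \<le> 2"
    by (rule Bob_enters_crown)
      (use abc edge_ab in \<open>auto simp: R_def legal_moves_def independent_set_iff insert_commute\<close>)
  finally show ?thesis .
qed

lemma Bob_enters_crown_ac: "rounds_to_go G Bob (R - {a, c}) {a, c} \<le> 2"
  by (rule Bob_enters_crown)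
    (use abc edge_ab nonedges in \<open>auto simp: R_def legal_moves_def independent_set_iff insert_commute\<close>)

text \<open>Alice answers in the crown on the same side, answers \<open>a\<close> or
  \<open>b\<close> by \<open>c\<close>, and \<open>c\<close> by \<open>a\<close>. In the last cases
  no move outside the crown is left, so Bob must enter it.\<close>

lemma Bob_R_le: "rounds_to_go G Bob R {} \<le> 2"
proof (rule Bob_all_moves)
  interpret swap: gadget G J b a c by (rule swap)
  have R_swap: "swap.R = R" by (auto simp: R_def swap.R_def)
  have reply: "rounds_to_go G Alice (R - {v}) {v} \<le> rounds_to_go G Bob (R - {v, w}) {v, w}"
    if "v \<in> R" "w \<in> R" "v \<noteq> w" "{v, w} \<notin> edges G" for v w
  proof -
    have "w \<in> legal_moves G (R - {v}) {v}"
      using that by (auto simp: legal_moves_def independent_set_iff insert_commute)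
    from Alice_move[OF _ this] finite_R
    have "rounds_to_go G Alice (R - {v}) {v} \<le> rounds_to_go G Bob (R - {v} - {w}) {w, v}" by simp
    moreover have "R - {v} - {w} = R - {v, w}" "{w, v} = {v, w}" by auto
    ultimately show ?thesis by simp
  qed
  have in_R: "a \<in> R" "b \<in> R" "c \<in> R" by (auto simp: R_def)
  fix v assume "v \<in> legal_moves G R {}"
  then consider "v \<in> pairs J" | "v = a" | "v = b" | "v = c" by (auto simp: R_def)
  then show "rounds_to_go G Alice (R - {v}) {v} \<le> 2"
  proof cases
    case 1
    then show ?thesis using Alice_same_side[of R "{}" v] by (auto simp: R_def)
  next
    case 2
    then show ?thesis using reply[of a c] Bob_enters_crown_ac abc nonedges in_R by simp
  next
    case 3
    then show ?thesis
      using reply[of b c] swap.Bob_enters_crown_ac abc nonedges in_R unfolding R_swap by simp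
  next
    case 4
    then show ?thesis using reply[of c a] Bob_enters_crown_ac abc nonedges in_R
      by (simp add: insert_commute)
  qed
qed (use finite_R in \<open>auto simp: R_def\<close>)

text \<open>The isolated vertex serves Alice as a waiting move, after which Bob must enter the
  crown.\<close>

lemma Alice_crown_a_le: "rounds_to_go G Alice (pairs J \<union> {a}) {} \<le> 2"
proof -
  have "rounds_to_go G Alice (pairs J \<union> {a}) {} \<le> rounds_to_go G Bob (pairs J) {a}"
    using Alice_move[of "pairs J \<union> {a}" a G "{}"] finite_pairs[OF finite_J] abc by simp
  also have "\<dots> \<le> 2"
    by (rule Bob_enters_crown) (use abc in \<open>auto simp: R_def legal_moves_def\<close>)
  finally show ?thesis .
qed

text \<open>Alice opens in the crown. If the mate is never colored in this round, the rest is
  independent. Otherwise the round ends with the pair, \<open>c\<close> and one of \<open>a\<close>,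
  \<open>b\<close>, and the other of these is her waiting move on the smaller crown.\<close>

lemma Alice_R_le:
  assumes "3 \<le> card J"
  shows "rounds_to_go G Alice R {} \<le> 3"
proof -
  obtain v w where v: "v \<in> pairs J" "{v, w} \<in> edges G"
    using crown_edge_in[OF crown_J card_J] .
  have "rounds_to_go G Alice R {} \<le> rounds_to_go G Bob (R - {v}) {v}"
    using Alice_move[of R v G "{}"] finite_R v by (simp add: R_def)
  also have "\<dots> \<le> Suc 2"
  proof (rule round_le)
    fix S assume S: "maximal_class G (R - {v}) {v} S"
    have SR: "S \<subseteq> R" "v \<in> S" using maximal_classD(1,2)[OF S] v by (auto simp: R_def)
    show "rounds_to_go G (turn Bob (card (S - {v}))) (R - {v} - S) {} \<le> 2"
    proof (cases "mate v \<in> S")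
      case True
      have SJ: "S \<inter> pairs J = {v, mate v}"
        by (rule maximal_class_pair[OF crown_J S v(1) SR(2) True])
      have c: "c \<in> S"
      proof (rule maximal_classD(4)[OF S])
        fix s assume "s \<in> S"
        then have "s \<in> pairs J \<or> s = a \<or> s = b \<or> s = c" using SR by (auto simp: R_def)
        then show "{c, s} \<notin> edges G"
          using isolated[of c s] no_loop nonedges by (auto simp: insert_commute)
      qed (use v abc in \<open>auto simp: R_def\<close>)
      have "a \<in> S \<or> b \<in> S"
      proof (rule ccontr)
        assume "\<not> (a \<in> S \<or> b \<in> S)"
        moreover have "a \<in> S" if "b \<notin> S"
        proof (rule maximal_classD(4)[OF S])
          fix s assume "s \<in> S"
          then have "s \<in> pairs J \<or> s = a \<or> s = c" using SR that by (auto simp: R_def)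
          then show "{a, s} \<notin> edges G" using isolated[of a s] no_loop nonedges by auto
        qed (use v abc in \<open>auto simp: R_def\<close>)
        ultimately show False by auto
      qed
      moreover have "\<not> (a \<in> S \<and> b \<in> S)" using maximal_classD(3)[OF S, of a b] edge_ab abc by auto
      ultimately obtain t t' where t: "{t, t'} = {a, b}" "t \<in> S" "t' \<notin> S" by (metis insert_commute)
      have "S = {v, mate v, c, t}"
        using SJ SR c t by (auto simp: R_def doubleton_eq_iff)
      moreover have "distinct [v, mate v, c, t]"
        using v abc mate_in_pairs[of v J] t by (auto simp: doubleton_eq_iff)
      ultimately have "card (S - {v}) = 3" by simp
      \<comment> \<open>The class has four vertices, so Bob makes the last move and Alice opens the
        next round.\<close>
      then have q: "turn Bob (card (S - {v})) = Alice" by (simp add: turn_def)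
      have "R - {v} - S = (pairs J - {v, mate v}) \<union> {t'}"
        using SJ SR c t abc by (auto simp: R_def doubleton_eq_iff)
      then have rest: "R - {v} - S = pairs (J - {v div 2}) \<union> {t'}" by (simp only: pairs_remove)
      interpret g: gadget G "J - {v div 2}" a b c
        by (rule remove_pair) (use v assms in \<open>auto simp: pairs_def\<close>)
      interpret g': gadget G "J - {v div 2}" b a c by (rule g.swap)
      have "t' = a \<or> t' = b" using t by (auto simp: doubleton_eq_iff)
      then show ?thesis
        unfolding q rest using g.Alice_crown_a_le g'.Alice_crown_a_le by auto
    next
      case False
      have side: "S \<inter> pairs J \<subseteq> {u \<in> pairs J. even u = even v}"
      proof
        fix u assume u: "u \<in> S \<inter> pairs J"
        show "u \<in> {u \<in> pairs J. even u = even v}"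
        proof (rule ccontr)
          assume "u \<notin> {u \<in> pairs J. even u = even v}"
          then have ne: "even u \<noteq> even v" using u by auto
          then have "{u, v} \<notin> edges G" using maximal_classD(3)[OF S, of u v] SR u by auto
          then have "u = mate v" using crown_edge[OF crown_J _ v(1), of u] u ne
            by (auto simp: div2_eq_iff)
          then show False using False u by auto
        qed
      qed
      have "independent_set G (R - {v} - S)"
        by (rule rest_independent[OF S _ side]) (use v in \<open>auto simp: R_def\<close>)
      then have "rounds_to_go G (turn Bob (card (S - {v}))) (R - {v} - S) {} \<le> 1"
        by (intro independent_le_1) (use finite_R no_loop in auto)
      then show ?thesis by simp
    qed
  qed (use finite_R in auto)
  finally show ?thesis by simp
qed

text \<open>Without \<open>a\<close> both \<open>b\<close> and \<open>c\<close> are isolated, and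
  Bob can pair all moves: crown vertices with their mates, \<open>b\<close> with \<open>c\<close>.
  The first round consists of a pair, \<open>b\<close> and \<open>c\<close>, and Alice opens again
  on a crown with one pair fewer.\<close>

lemma R_minus_a_ge: "card J \<le> rounds_to_go G Alice (R - {a}) {}"
proof -
  have R_a: "R - {a} = pairs J \<union> {b, c}" using abc by (auto simp: R_def)
  have fin: "finite (pairs J \<union> {b, c})" using finite_pairs[OF finite_J] by simp
  have after_pair: "card J \<le> rounds_to_go G Alice U C"
    if "U \<union> C = pairs J \<union> {b, c}" "U \<inter> C = {}" "independent_set G C" "v \<in> C" "mate v \<in> C"
      "v \<in> pairs J" "even (card C)" for U C v
  proof -
    have finUC: "finite (U \<union> C)" unfolding that(1) by (rule fin)
    have finU: "finite U" using finUC by simp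
    have vJ: "v div 2 \<in> J" using that(6) by (simp add: pairs_def)
    have "Suc (card (J - {v div 2})) \<le> rounds_to_go G Alice U C"
    proof (rule round_ge)
      fix S assume S: "maximal_class G U C S"
      have CS: "C \<subseteq> S" "S \<subseteq> pairs J \<union> {b, c}" using maximal_classD(1,2)[OF S] that(1) by auto
      have SJ: "S \<inter> pairs J = {v, mate v}"
        by (rule maximal_class_pair[OF crown_J S that(6)]) (use CS that in auto)
      have bc: "t \<in> S" if t: "t \<in> {b, c}" for t
      proof (cases "t \<in> C")
        case False
        show ?thesis
        proof (rule maximal_classD(4)[OF S])
          show "t \<in> U" using t False \<open>U \<union> C = pairs J \<union> {b, c}\<close> by blast
          fix s assume "s \<in> S"
          then have "s \<in> pairs J \<or> s = b \<or> s = c" using CS by auto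
          then show "{t, s} \<notin> edges G"
            using isolated[of t s] t no_loop nonedges by (auto simp: insert_commute)
        qed
      qed (use CS in auto)
      have Seq: "S = {v, mate v, b, c}" using SJ bc CS(2) by blast
      moreover have "distinct [v, mate v, b, c]"
        using abc that(6) mate_in_pairs[of v J] by auto
      ultimately have "card S = 4" by simp
      moreover have "finite C" using finUC by simp
      \<comment> \<open>Alice is on move and an even number of the four vertices of \<open>S\<close>
        is left, so she also opens the next round.\<close>
      ultimately have "even (card (S - C))"
        using that(7) CS(1) card_Diff_subset[of C S] card_mono[of S C] Seq by simp
      then have q: "turn Alice (card (S - C)) = Alice" by (simp add: turn_def)
      have "U - S = U \<union> C - S" using CS(1) by auto
      also have "\<dots> = pairs J - {v, mate v}" unfolding that(1) using Seq abc by auto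
      finally have rest: "U - S = pairs (J - {v div 2})" by (simp only: pairs_remove)
      \<comment> \<open>The lower bound for joins with an empty second part, which satisfies its
        parity condition for Alice.\<close>
      have "card (J - {v div 2}) + rounds_to_go G Alice {} {} \<le>
          rounds_to_go G Alice (pairs (J - {v div 2}) \<union> {}) {}"
        by (rule crown_join_ge)
          (use crown_mono[OF crown_J] finite_J in \<open>auto simp: joined_def\<close>)
      then show "card (J - {v div 2}) \<le> rounds_to_go G (turn Alice (card (S - C))) (U - S) {}"
        unfolding q rest by simp
    qed (use finU that in auto)
    then show ?thesis using vJ finite_J by (metis card_Suc_Diff1)
  qed
  have mate_reply: "card J \<le> rounds_to_go G Bob (U - {v}) (insert v C)"
    if U: "U \<union> C = pairs J \<union> {b, c}" "U \<inter> C = {}" "C \<subseteq> {b, c}" "even (card C)"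
      and v: "v \<in> pairs J" for U C v
  proof -
    have finU: "finite U" "finite C" using U(1) fin by (metis finite_Un)+
    have out: "v \<notin> C" "mate v \<notin> C" using v U(3) abc mate_in_pairs[of v J] by auto
    have vU: "v \<in> U" "mate v \<in> U" using v U(1) out mate_in_pairs[of v J] by blast+
    have "independent_set G {b, c}" using nonedges(2) by (auto simp: independent_set_iff insert_commute)
    then have "independent_set G C" using U(3) independent_set_mono by blast
    moreover have "independent_set G {mate v, v}"
      using crown_edge[OF crown_J] v by (auto simp: independent_set_iff)
    ultimately have ind: "independent_set G (insert (mate v) (insert v C))"
      using independent_insert_pairs[of C "{mate v, v}"] U(3) v by auto
    have "card J \<le> rounds_to_go G Alice (U - {v} - {mate v}) (insert (mate v) (insert v C))"
    proof (rule after_pair)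
      show "U - {v} - {mate v} \<union> insert (mate v) (insert v C) = pairs J \<union> {b, c}"
        using vU U(1) by blast
    qed (use U ind v out finU in auto)
    also have "\<dots> \<le> rounds_to_go G Bob (U - {v}) (insert v C)"
      by (rule Bob_move) (use finU vU ind in \<open>auto simp: legal_moves_def\<close>)
    finally show ?thesis .
  qed
  have bc_reply: "card J \<le> rounds_to_go G Bob (pairs J \<union> {b, c} - {s}) {s}"
    if st: "{s, t} = {b, c}" "s \<noteq> t" for s t
  proof -
    let ?U = "pairs J \<union> {b, c} - {s}"
    have ind: "independent_set G {t, s}"
      using nonedges st by (auto simp: independent_set_iff doubleton_eq_iff insert_commute)
    have st': "s \<in> {b, c}" "t \<in> {b, c}" using st by blast+
    have U: "?U - {t} = pairs J" using st abc by (auto simp: doubleton_eq_iff)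
    have "card J \<le> rounds_to_go G Alice (pairs J) {t, s}"
    proof (rule Alice_all_moves)
      obtain u v where u: "u \<in> pairs J" "{u, v} \<in> edges G"
        using crown_edge_in[OF crown_J card_J] .
      moreover have "{t, s} \<subseteq> {a, b, c}" using st' by auto
      ultimately have "u \<in> legal_moves G (pairs J) {t, s}"
        using independent_insert_vertex[OF ind] by (simp add: legal_moves_def)
      then show "legal_moves G (pairs J) {t, s} \<noteq> {}" by auto
      fix v assume "v \<in> legal_moves G (pairs J) {t, s}"
      then have "v \<in> pairs J" by (simp add: legal_moves_def)
      then show "card J \<le> rounds_to_go G Bob (pairs J - {v}) (insert v {t, s})"
        by (intro mate_reply) (use st abc in \<open>auto simp: doubleton_eq_iff\<close>)
    qed (rule finite_pairs[OF finite_J])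
    also have "\<dots> = rounds_to_go G Alice (?U - {t}) {t, s}" by (simp only: U)
    also have "\<dots> \<le> rounds_to_go G Bob ?U {s}"
      by (rule Bob_move) (use fin st' st(2) ind in \<open>auto simp: legal_moves_def\<close>)
    finally show ?thesis .
  qed
  show ?thesis
    unfolding R_a
  proof (rule Alice_all_moves[OF fin])
    fix v assume "v \<in> legal_moves G (pairs J \<union> {b, c}) {}"
    then consider "v \<in> pairs J" | "v = b" | "v = c" by auto
    then show "card J \<le> rounds_to_go G Bob (pairs J \<union> {b, c} - {v}) {v}"
      using mate_reply[of "pairs J \<union> {b, c}" "{}" v] bc_reply[of b c] bc_reply[of c b] abc
      by cases auto
  qed simp
qed

lemma R_minus_a_le: "rounds_to_go G Alice (R - {a}) {} \<le> card J"
proof -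
  have "R - {a} = pairs J \<union> {b, c}" using abc by (auto simp: R_def)
  moreover have "rounds_to_go G Alice (pairs J \<union> {b, c}) {} \<le> max 1 (card J)"
    by (rule crown_isolated_le)
      (use crown_J finite_J no_loop nonedges isolated in \<open>auto simp: insert_commute\<close>)
  ultimately show ?thesis using card_J by simp
qed

end

section \<open>Join of the gadget with a second crown\<close>

text \<open>Three pairs let either crown lose one and keep an edge. Since \<open>card K\<close> is
  even, a round that colors a full side of the outer crown is followed by one with the same
  opener.\<close>

locale gadget_join = gadget +
  fixes K :: "nat set"
  assumes crown_K: "crown G K" and finite_K: "finite K" and card_K: "3 \<le> card K" "even (card K)"
    and card_J': "3 \<le> card J"
    and joined_KR: "joined G (pairs K) (pairs J \<union> {a, b, c})"
begin

section \<open>Deleting a vertex of the join\<close>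

lemma finite_verts: "finite (pairs K \<union> R)"
  using finite_pairs[OF finite_K] finite_R by simp

lemma joined_KR': "joined G (pairs K) R"
  using joined_KR by (simp add: R_def)

lemma disjoint_KR: "pairs K \<inter> R = {}"
  using joined_KR' by (simp add: joined_def)

lemma swap_join: "gadget_join G J b a c K"
  using swap gadget_join_axioms
  unfolding gadget_join_def gadget_join_axioms_def by (simp add: insert_commute)

text \<open>What counts is that \<open>R\<close> is odd and becomes even when a vertex is deleted;
  this decides who must open in the outer crown.\<close>

lemma card_R: "card R = 2 * card J + 3"
proof -
  have "card (pairs J) = card ({u \<in> pairs J. even u = True} \<union> {u \<in> pairs J. even u = False})"
    by (rule arg_cong[where f = card]) auto
  also have "\<dots> = card {u \<in> pairs J. even u = True} + card {u \<in> pairs J. even u = False}"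
    by (rule card_Un_disjoint) (use finite_pairs[OF finite_J] in auto)
  finally have "card (pairs J) = 2 * card J" unfolding card_side by simp
  then show ?thesis using abc finite_pairs[OF finite_J] by (simp add: R_def)
qed

lemma card_R_minus: "x \<in> R \<Longrightarrow> even (card (R - {x}))"
  using card_R finite_R by simp

text \<open>Alice opens and \<open>R - {x}\<close> is even, so Bob can make the outer crown last
  \<open>card K\<close> rounds; the upper bound for joins with \<open>k = card K\<close> matches
  this.\<close>

lemma join_R_minus_eq:
  assumes "x \<in> R" "rounds_to_go G Alice (R - {x}) {} = k"
  shows "rounds_to_go G Alice (pairs K \<union> R - {x}) {} = card K + k"
proof -
  have eq: "pairs K \<union> R - {x} = pairs K \<union> (R - {x})" using assms(1) disjoint_KR by auto
  have "joined G (pairs K) (R - {x})" using joined_mono[OF joined_KR'] by auto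
  then have "rounds_to_go G Alice (pairs K \<union> (R - {x})) {} \<le>
      card K + rounds_to_go G Alice (R - {x}) {}"
    using crown_K finite_K card_K finite_R no_loop by (intro crown_join_le) auto
  moreover have "card K + rounds_to_go G Alice (R - {x}) {} \<le>
      rounds_to_go G Alice (pairs K \<union> (R - {x})) {}"
    by (rule crown_join_ge)
      (use crown_K finite_K finite_R card_R_minus[OF assms(1)]
        \<open>joined G (pairs K) (R - {x})\<close> in auto)
  ultimately show ?thesis using eq assms(2) by simp
qed

lemma delete_crown_vertex:
  assumes "x \<in> pairs J"
  shows "rounds_to_go G Alice (pairs K \<union> R - {x}) {} = card K + 2"
proof (rule join_R_minus_eq)
  have J': "2 \<le> card (J - {x div 2})" using card_J' finite_J by (auto simp: card_Diff_singleton_if)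
  have "pairs (J - {x div 2}) \<subseteq> R - {x}"
    by (auto simp: R_def pairs_def)
  then have "2 \<le> rounds_to_go G Alice (R - {x}) {}"
    using two_le_crown[OF _ J'] crown_mono[OF crown_J] finite_R by auto
  then show "rounds_to_go G Alice (R - {x}) {} = 2" using R_minus_crown_vertex_le[OF assms] by simp
qed (use assms in \<open>simp add: R_def\<close>)

lemma delete_c: "rounds_to_go G Alice (pairs K \<union> R - {c}) {} = card K + 2"
proof (rule join_R_minus_eq)
  have "pairs J \<subseteq> R - {c}" using abc by (auto simp: R_def)
  then have "2 \<le> rounds_to_go G Alice (R - {c}) {}"
    using two_le_crown[OF crown_J card_J] finite_R by auto
  then show "rounds_to_go G Alice (R - {c}) {} = 2" using R_minus_c_le by simp
qed (simp add: R_def)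

lemma delete_a: "rounds_to_go G Alice (pairs K \<union> R - {a}) {} = card K + card J"
  by (rule join_R_minus_eq) (use R_minus_a_le R_minus_a_ge in \<open>auto simp: R_def\<close>)

lemma remove_pair_joined: "joined G (pairs K) (pairs (J - I))" "joined G (pairs (K - I)) (pairs J)"
  using joined_mono[OF joined_KR] pairs_mono[of "J - I" J] pairs_mono[of "K - I" K] by blast+

text \<open>Alice opens with the mate of \<open>v\<close>, so the first round colors that full side.
  She opens again, on the other side, which has odd size without \<open>v\<close>, and Bob has to
  open on \<open>R\<close>, where two rounds are enough. A four-clique gives the lower
  bound.\<close>

lemma delete_outer:
  assumes "v \<in> pairs K"
  shows "rounds_to_go G Alice (pairs K \<union> R - {v}) {} = 4"
proof (rule antisym)
  let ?V = "pairs K \<union> R - {v}"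
  let ?side = "\<lambda>x. {u \<in> pairs K. even u = x}"
  have K': "2 \<le> card (K - {v div 2})" using card_K(1) finite_K by (auto simp: card_Diff_singleton_if)
  have "pairs (K - {v div 2}) \<union> pairs J \<subseteq> ?V"
    using assms disjoint_KR by (auto simp: R_def pairs_def)
  then show "4 \<le> rounds_to_go G Alice ?V {}"
    using four_le_crown_join[OF crown_J card_J crown_mono[OF crown_K] K'] finite_verts
      remove_pair_joined(2) by auto
  have vR: "v \<notin> R" "mate v \<notin> R" using assms disjoint_KR mate_in_pairs[of v K] by blast+
  have mK: "mate v \<in> pairs K" using assms by simp
  let ?I = "?side (even v) - {v}"
  have joinI: "joined G ?I R" by (rule joined_mono[OF joined_KR' _ order_refl]) auto
  have indI: "independent_set G ?I"
    by (rule independent_set_mono[OF independent_side[OF crown_K, of "even v"]]) auto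
  have finI: "finite ?I" using finite_pairs[OF finite_K] by simp
  have Alice_IR: "rounds_to_go G Alice (?I \<union> R) {} \<le> 3"
  proof -
    have "2 \<le> card K" using card_K by simp
    then obtain z where z: "z \<in> pairs K" "z \<noteq> v" "even z = even v"
      using other_on_side[OF assms] by metis
    have zI: "z \<in> ?I" "z \<notin> R" using z disjoint_KR by auto
    have "rounds_to_go G Alice (?I \<union> R) {} \<le> rounds_to_go G Bob (?I \<union> R - {z}) {z}"
      using Alice_move[of "?I \<union> R" z G "{}"] finI finite_R zI by simp
    also have "\<dots> \<le> Suc 2"
    proof (rule round_le)
      fix S assume S: "maximal_class G (?I \<union> R - {z}) {z} S"
      have SI: "S = ?I"
        by (rule maximal_class_independent_joined[OF S joinI indI, of z]) (use zI in auto)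
      have "v \<in> ?side (even v)" using assms by simp
      then have "card ?I = card K - 1" using card_side[of K "even v"] finite_pairs[OF finite_K] by simp
      then have "card (S - {z}) = card K - 2" using zI finI unfolding SI by (simp del: Diff_insert0)
      \<comment> \<open>Alice makes the first and the last of the \<open>card K - 1\<close> moves,
        so Bob opens on \<open>R\<close>.\<close>
      then have "turn Bob (card (S - {z})) = Bob" using card_K by (simp add: turn_def)
      moreover have "?I \<union> R - {z} - S = R" using zI disjoint_KR unfolding SI by auto
      ultimately show "rounds_to_go G (turn Bob (card (S - {z}))) (?I \<union> R - {z} - S) {} \<le> 2"
        using Bob_R_le by simp
    qed (use finI finite_R in auto)
    finally show ?thesis by simp
  qed
  have "rounds_to_go G Alice ?V {} \<le> rounds_to_go G Bob (?V - {mate v}) {mate v}"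
    using Alice_move[of ?V "mate v" G "{}"] finite_verts mK by simp
  also have "\<dots> \<le> Suc 3"
  proof (rule round_le)
    fix S assume S: "maximal_class G (?V - {mate v}) {mate v} S"
    have SR: "S \<inter> R = {}"
      using maximal_class_joined[OF S joined_KR', of "mate v"] mK by simp
    have mS: "mate v \<in> S" using maximal_classD(1)[OF S] by simp
    have SK: "S \<subseteq> pairs K - {v}" using maximal_classD(2)[OF S] SR mK by auto
    have par: "even u = odd v" if u: "u \<in> S" for u
    proof (rule ccontr)
      assume ne: "even u \<noteq> odd v"
      have "u \<in> pairs K" "u \<noteq> v" using SK u by auto
      moreover have "u \<noteq> mate v" using ne by auto
      moreover have "{u, mate v} \<notin> edges G" using maximal_classD(3)[OF S u mS] calculation by simp
      ultimately show False using crown_edge[OF crown_K _ mK, of u] ne by (simp add: div2_eq_iff)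
    qed
    have "u \<in> S" if u: "u \<in> ?side (odd v)" for u
    proof (rule ccontr)
      assume nS: "u \<notin> S"
      have uK: "u \<in> pairs K" "u \<noteq> v" "u \<noteq> mate v" using u nS mS by auto
      have "{u, s} \<notin> edges G" if "s \<in> S" for s
        using crown_edge[OF crown_K uK(1), of s] SK par[OF that] u that by auto
      then show False using maximal_classD(4)[OF S, of u] uK nS by auto
    qed
    then have "?side (odd v) \<subseteq> S" by blast
    moreover have "u \<in> ?side (odd v)" if "u \<in> S" for u
      using that SK par[OF that] by blast
    ultimately have Seq: "S = ?side (odd v)" by blast
    have "card S = card K" unfolding Seq by (rule card_side)
    then have "card (S - {mate v}) = card K - 1" using mS by simp
    \<comment> \<open>The full side takes an even number of moves, so Alice opens again.\<close>
    then have "turn Bob (card (S - {mate v})) = Alice" using card_K by (simp add: turn_def)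
    moreover have "?V - {mate v} - S = ?I \<union> R" using vR disjoint_KR mS unfolding Seq by auto
    ultimately show "rounds_to_go G (turn Bob (card (S - {mate v}))) (?V - {mate v} - S) {} \<le> 3"
      using Alice_IR by simp
  qed (use finite_verts in auto)
  finally show "rounds_to_go G Alice ?V {} \<le> 4" by simp
qed

section \<open>The value of the whole join\<close>

lemma five_le_after_pair:
  assumes "U \<union> C = pairs K \<union> R" "U \<inter> C = {}" "independent_set G C"
    and "v \<in> C" "mate v \<in> C" "v \<in> pairs K \<or> v \<in> pairs J"
  shows "5 \<le> rounds_to_go G p U C"
proof -
  have fin: "finite U" using finite_verts assms(1) by (metis finite_Un)
  \<comment> \<open>The pair stops all other play on its crown, and the class avoids the crown
    across the join. Both crowns keep an edge, hence four more rounds however the play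
    continues.\<close>
  have "Suc 4 \<le> rounds_to_go G p U C"
  proof (rule round_ge)
    fix S assume S: "maximal_class G U C S"
    have CS: "C \<subseteq> S" using maximal_classD(1)[OF S] .
    then have rest: "U - S = pairs K \<union> R - S" using assms(1) by auto
    show "4 \<le> rounds_to_go G (turn p (card (S - C))) (U - S) {}"
    proof (cases "v \<in> pairs K")
      case True
      have "S \<inter> pairs K = {v, mate v}"
        by (rule maximal_class_pair[OF crown_K S True]) (use CS assms in auto)
      moreover have "S \<inter> R = {}" by (rule maximal_class_joined[OF S joined_KR' assms(4) True])
      ultimately have "pairs (K - {v div 2}) \<union> pairs J \<subseteq> U - S"
        unfolding rest pairs_remove[symmetric] by (auto simp: R_def)
      moreover have "2 \<le> card (K - {v div 2})"
        using card_K(1) finite_K by (auto simp: card_Diff_singleton_if)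
      ultimately show ?thesis
        by (intro four_le_crown_join[where J = J and K = "K - {v div 2}"])
          (use crown_J card_J crown_mono[OF crown_K] fin remove_pair_joined(2) in auto)
    next
      case False
      then have v: "v \<in> pairs J" using assms(6) by simp
      then have vR: "v \<in> R" by (simp add: R_def)
      have "S \<inter> pairs J = {v, mate v}"
        by (rule maximal_class_pair[OF crown_J S v]) (use CS assms in auto)
      moreover have "S \<inter> pairs K = {}" by (rule maximal_class_joined'[OF S joined_KR' assms(4) vR])
      ultimately have "pairs K \<union> pairs (J - {v div 2}) \<subseteq> U - S"
        unfolding rest pairs_remove[symmetric] by (auto simp: R_def)
      moreover have "2 \<le> card (J - {v div 2})"
        using card_J' finite_J by (auto simp: card_Diff_singleton_if)
      moreover have "2 \<le> card K" using card_K by simp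
      ultimately show ?thesis
        by (intro four_le_crown_join[where J = "J - {v div 2}" and K = K])
          (use crown_K crown_mono[OF crown_J] fin remove_pair_joined(1) in auto)
    qed
  qed (use fin assms in auto)
  then show ?thesis by simp
qed

text \<open>Bob answers by the mate. In the inner crown this is possible even if some of
  \<open>a\<close>, \<open>b\<close>, \<open>c\<close> are already colored; in the outer crown the
  round must have begun with \<open>v\<close>.\<close>

lemma Bob_mate_reply:
  assumes "U \<union> C = pairs K \<union> R" "U \<inter> C = {}" "C \<subseteq> {a, b, c}" "independent_set G C"
    and "v \<in> pairs J \<or> v \<in> pairs K \<and> C = {}"
  shows "5 \<le> rounds_to_go G Bob (U - {v}) (insert v C)"
proof -
  have fin: "finite U" using finite_verts assms(1) by (metis finite_Un)
  have out: "v \<notin> C" "mate v \<notin> C" using assms(3,5) abc mate_in_pairs[of v J] by auto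
  have m: "mate v \<in> pairs K \<or> mate v \<in> pairs J" using assms(5) by auto
  have "v \<in> U \<union> C" "mate v \<in> U \<union> C" unfolding assms(1) R_def using assms(5) m by blast+
  then have vU: "v \<in> U" "mate v \<in> U" using out by blast+
  have ind2: "independent_set G {mate v, v}"
    using crown_edge[OF crown_J] crown_edge[OF crown_K] assms(5) by (auto simp: independent_set_iff)
  have ind: "independent_set G (insert (mate v) (insert v C))"
  proof (cases "v \<in> pairs J")
    case True
    then show ?thesis using independent_insert_pairs[OF assms(4,3) ind2] by simp
  next
    case False
    then show ?thesis using assms(5) ind2 by simp
  qed
  have "5 \<le> rounds_to_go G Alice (U - {v} - {mate v}) (insert (mate v) (insert v C))"
  proof (rule five_le_after_pair)
    show "U - {v} - {mate v} \<union> insert (mate v) (insert v C) = pairs K \<union> R"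
      using vU assms(1) by blast
  qed (use assms ind in auto)
  also have "\<dots> \<le> rounds_to_go G Bob (U - {v}) (insert v C)"
    by (rule Bob_move) (use fin vU ind in \<open>auto simp: legal_moves_def\<close>)
  finally show ?thesis .
qed

text \<open>Now \<open>b\<close> and the outer crown are blocked, so Alice must enter the inner
  crown and Bob answers by the mate.\<close>

lemma five_le_after_ac: "5 \<le> rounds_to_go G Alice (pairs K \<union> R - {a, c}) {a, c}"
proof (rule Alice_all_moves)
  let ?U = "pairs K \<union> R - {a, c}"
  show "finite ?U" using finite_verts by simp
  have ind: "independent_set G {a, c}"
    using nonedges by (auto simp: independent_set_iff insert_commute)
  have aR: "a \<in> R" "c \<in> R" by (auto simp: R_def)
  obtain u w where u: "u \<in> pairs J" "{u, w} \<in> edges G" using crown_edge_in[OF crown_J card_J] .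
  have "u \<in> ?U" using u abc by (auto simp: R_def)
  then have "u \<in> legal_moves G ?U {a, c}"
    using independent_insert_vertex[OF ind] u by (simp add: legal_moves_def)
  then show "legal_moves G ?U {a, c} \<noteq> {}" by auto
  fix v assume v: "v \<in> legal_moves G ?U {a, c}"
  then have vU: "v \<in> ?U" "independent_set G (insert v {a, c})" by (auto simp: legal_moves_def)
  have na: "{v, a} \<notin> edges G"
    by (rule independent_setD[OF vU(2)]) (use vU(1) in auto)
  then have "v \<notin> pairs K" using joined_KR' aR by (auto simp: joined_def)
  moreover have "v \<noteq> b" using na edge_ab by (auto simp: insert_commute)
  ultimately have "v \<in> pairs J" using vU(1) by (auto simp: R_def)
  then show "5 \<le> rounds_to_go G Bob (?U - {v}) (insert v {a, c})"
    by (intro Bob_mate_reply) (use ind aR in auto)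
qed

text \<open>Bob answers crown vertices by their mates, \<open>a\<close> or \<open>b\<close> by
  \<open>c\<close>, and \<open>c\<close> by \<open>a\<close>; either way a pair comes into the first
  round.\<close>

lemma join_eq_5: "rounds_to_go G Alice (pairs K \<union> R) {} = 5"
proof (rule antisym)
  interpret swap: gadget_join G J b a c K by (rule swap_join)
  have R_swap: "swap.R = R" by (auto simp: R_def swap.R_def)
  \<comment> \<open>Alice moves and \<open>R\<close> is odd, so the condition that would require
    \<open>card K \<le> k\<close> is void and \<open>k = 2\<close> is allowed.\<close>
  have "rounds_to_go G Alice (pairs K \<union> R) {} \<le> 2 + rounds_to_go G Alice R {}"
    using crown_K finite_K card_K finite_R no_loop joined_KR' card_R
    by (intro crown_join_le) auto
  then show "rounds_to_go G Alice (pairs K \<union> R) {} \<le> 5" using Alice_R_le[OF card_J'] by simp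
  have reply: "rounds_to_go G Alice (pairs K \<union> R - {v, w}) {v, w} \<le>
      rounds_to_go G Bob (pairs K \<union> R - {v}) {v}"
    if "v \<in> R" "w \<in> R" "v \<noteq> w" "{v, w} \<notin> edges G" for v w
  proof -
    have "w \<in> legal_moves G (pairs K \<union> R - {v}) {v}"
      using that by (auto simp: legal_moves_def independent_set_iff insert_commute)
    from Bob_move[OF _ this] finite_verts
    have "rounds_to_go G Alice (pairs K \<union> R - {v} - {w}) {w, v} \<le>
        rounds_to_go G Bob (pairs K \<union> R - {v}) {v}" by simp
    moreover have "pairs K \<union> R - {v} - {w} = pairs K \<union> R - {v, w}" "{w, v} = {v, w}" by auto
    ultimately show ?thesis by simp
  qed
  have in_R: "a \<in> R" "b \<in> R" "c \<in> R" by (auto simp: R_def)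
  show "5 \<le> rounds_to_go G Alice (pairs K \<union> R) {}"
  proof (rule Alice_all_moves[OF finite_verts])
    show "legal_moves G (pairs K \<union> R) {} \<noteq> {}" using in_R by auto
    fix v assume "v \<in> legal_moves G (pairs K \<union> R) {}"
    then consider "v \<in> pairs J \<or> v \<in> pairs K" | "v = a" | "v = b" | "v = c" by (auto simp: R_def)
    then show "5 \<le> rounds_to_go G Bob (pairs K \<union> R - {v}) {v}"
    proof cases
      case 1
      then show ?thesis using Bob_mate_reply[of "pairs K \<union> R" "{}" v] by auto
    next
      case 2
      then show ?thesis using reply[of a c] five_le_after_ac abc nonedges in_R by simp
    next
      case 3
      then show ?thesis
        using reply[of b c] swap.five_le_after_ac abc nonedges in_R unfolding R_swap by simp
    next
      case 4
      have "{c, a} = {a, c}" by auto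
      then show ?thesis using reply[of c a] five_le_after_ac abc nonedges in_R 4 by simp
    qed
  qed
qed

end

section \<open>The graph\<close>

text \<open>The vertices \<open>0, \<dots>, 7\<close> and \<open>8, 9, 10\<close> form the gadget with the edge \<open>{8, 9}\<close>; the vertices
  from \<open>12\<close> on form the second crown.\<close>

definition gadget_adj :: "nat \<Rightarrow> nat \<Rightarrow> bool" where
  "gadget_adj u v \<longleftrightarrow> (u < 12) \<noteq> (v < 12) \<or> u \<noteq> v \<and> u \<in> {8, 9} \<and> v \<in> {8, 9} \<or>
    even u \<noteq> even v \<and> u div 2 \<noteq> v div 2 \<and> (u < 8 \<and> v < 8 \<or> 12 \<le> u \<and> 12 \<le> v)"

text \<open>The pair indices of the second crown start at 6, which skips the number 11, the would-be
  mate of the single vertex 10.\<close>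

definition gadget_verts :: "nat \<Rightarrow> nat set" where
  "gadget_verts m = pairs {6..<6 + m} \<union> (pairs {..<4} \<union> {8, 9, 10})"

definition gadget_graph :: "nat \<Rightarrow> nat graph" where
  "gadget_graph m = \<lparr>verts = gadget_verts m,
    edges = {{u, v} | u v. u \<in> gadget_verts m \<and> v \<in> gadget_verts m \<and> gadget_adj u v}\<rparr>"

section \<open>Properties of the concrete graph\<close>

lemma verts_gadget_graph: "verts (gadget_graph m) = gadget_verts m"
  by (simp add: gadget_graph_def)

lemma gadget_adj_sym: "gadget_adj u v \<longleftrightarrow> gadget_adj v u"
  unfolding gadget_adj_def by metis

lemma gadget_adj_irrefl: "\<not> gadget_adj v v"
  by (simp add: gadget_adj_def)

lemma edge_gadget_graph:
  "{u, v} \<in> edges (gadget_graph m) \<longleftrightarrow>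
    u \<in> gadget_verts m \<and> v \<in> gadget_verts m \<and> gadget_adj u v"
  using gadget_adj_sym by (auto simp: gadget_graph_def doubleton_eq_iff)

lemma simple_gadget_graph: "simple_graph (gadget_graph m)"
proof -
  have "finite (gadget_verts m)" by (simp add: gadget_verts_def finite_pairs)
  moreover have "card {u, v} = 2" if "gadget_adj u v" for u v
    using that gadget_adj_irrefl by (cases "u = v") auto
  ultimately show ?thesis by (auto simp: simple_graph_def gadget_graph_def)
qed

text \<open>Both orders of 8 and 9 are covered because \<open>delete_a\<close> deals only with the
  first endpoint of the edge.\<close>

lemma gadget_join_graph:
  assumes "3 \<le> m" "even m" "(a, b) = (8, 9) \<or> (a, b) = (9, 8)"
  shows "gadget_join (gadget_graph m) {..<4} a b 10 {6..<6 + m}"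
proof
  have lt: "v < 8" if "v \<in> pairs {..<4}" for v using that by (auto simp: pairs_def)
  have ge: "12 \<le> v" if "v \<in> pairs {6..<6 + m}" for v using that by (auto simp: pairs_def)
  have in_V: "v \<in> gadget_verts m" if "v \<in> pairs {..<4} \<or> v \<in> pairs {6..<6 + m} \<or> v \<in> {8, 9, 10}" for v
    using that by (auto simp: gadget_verts_def)
  show "crown (gadget_graph m) {..<4}"
    unfolding crown_def
  proof (intro ballI)
    fix u v assume uv: "u \<in> pairs {..<4}" "v \<in> pairs {..<4}"
    then show "{u, v} \<in> edges (gadget_graph m) \<longleftrightarrow> even u \<noteq> even v \<and> u div 2 \<noteq> v div 2"
      using lt[OF uv(1)] lt[OF uv(2)] in_V by (simp add: edge_gadget_graph gadget_adj_def)
  qed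
  show "crown (gadget_graph m) {6..<6 + m}"
    unfolding crown_def
  proof (intro ballI)
    fix u v assume uv: "u \<in> pairs {6..<6 + m}" "v \<in> pairs {6..<6 + m}"
    then show "{u, v} \<in> edges (gadget_graph m) \<longleftrightarrow> even u \<noteq> even v \<and> u div 2 \<noteq> v div 2"
      using ge[OF uv(1)] ge[OF uv(2)] in_V by (simp add: edge_gadget_graph gadget_adj_def)
  qed
  show "{v} \<notin> edges (gadget_graph m)" for v
    using edge_gadget_graph[of v v m] gadget_adj_irrefl by simp
  show "{a, b} \<in> edges (gadget_graph m)" "{a, 10} \<notin> edges (gadget_graph m)"
    "{b, 10} \<notin> edges (gadget_graph m)"
    using assms(3) in_V[of 8] in_V[of 9] by (auto simp: edge_gadget_graph gadget_adj_def)
  show "a \<noteq> b" "a \<noteq> 10" "b \<noteq> 10" "a \<notin> pairs {..<4}" "b \<notin> pairs {..<4}" "10 \<notin> pairs {..<4}"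
    using assms(3) by (auto simp: pairs_def)
  show "{t, u} \<notin> edges (gadget_graph m)" if "t \<in> {a, b, 10}" "u \<in> pairs {..<4}" for t u
    using that(1) lt[OF that(2)] assms(3) by (auto simp: edge_gadget_graph gadget_adj_def)
  show "joined (gadget_graph m) (pairs {6..<6 + m}) (pairs {..<4} \<union> {a, b, 10})"
    unfolding joined_def
  proof (intro conjI ballI)
    show "pairs {6..<6 + m} \<inter> (pairs {..<4} \<union> {a, b, 10}) = {}"
      using lt ge assms(3) by (fastforce dest: ge lt)
    fix u v assume u: "u \<in> pairs {6..<6 + m}" and v: "v \<in> pairs {..<4} \<union> {a, b, 10}"
    have "v < 12" using v lt[of v] assms(3) by auto
    moreover have "v \<in> gadget_verts m" using v in_V[of v] assms(3) by auto
    ultimately show "{u, v} \<in> edges (gadget_graph m)"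
      using ge[OF u] in_V[of u] u by (simp add: edge_gadget_graph gadget_adj_def)
  qed
qed (use assms in auto)

text \<open>The removed edges all contain \<open>x\<close>, which does not occur in the position, so
  the game may be played with the edges of \<open>G\<close>.\<close>

lemma chi_delete_vertex:
  "chi_ig_AB (delete_vertex G x) = rounds_to_go G Alice (verts G - {x}) {}"
  unfolding chi_ig_AB_def delete_vertex_def by (simp, rule rounds_to_go_cong) auto

lemma chi_gadget_graph:
  assumes "3 \<le> m" "even m"
  shows "chi_ig_AB (gadget_graph m) = 5"
    and "x \<in> pairs {6..<6 + m} \<Longrightarrow> chi_ig_AB (delete_vertex (gadget_graph m) x) = 4"
    and "x \<in> pairs {..<4} \<union> {10} \<Longrightarrow> chi_ig_AB (delete_vertex (gadget_graph m) x) = m + 2"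
    and "x \<in> {8, 9} \<Longrightarrow> chi_ig_AB (delete_vertex (gadget_graph m) x) = m + 4"
proof -
  interpret g: gadget_join "gadget_graph m" "{..<4}" 8 9 10 "{6..<6 + m}"
    by (rule gadget_join_graph) (use assms in auto)
  interpret h: gadget_join "gadget_graph m" "{..<4}" 9 8 10 "{6..<6 + m}"
    by (rule gadget_join_graph) (use assms in auto)
  have V: "gadget_verts m = pairs {6..<6 + m} \<union> g.R" "gadget_verts m = pairs {6..<6 + m} \<union> h.R"
    by (auto simp: gadget_verts_def g.R_def h.R_def)
  show "chi_ig_AB (gadget_graph m) = 5"
    using g.join_eq_5 by (simp add: chi_ig_AB_def verts_gadget_graph V(1))
  show "chi_ig_AB (delete_vertex (gadget_graph m) x) = 4" if "x \<in> pairs {6..<6 + m}"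
    using g.delete_outer[OF that] by (simp add: chi_delete_vertex verts_gadget_graph V(1))
  show "chi_ig_AB (delete_vertex (gadget_graph m) x) = m + 2" if "x \<in> pairs {..<4} \<union> {10}"
    using that g.delete_crown_vertex[of x] g.delete_c by (auto simp: chi_delete_vertex verts_gadget_graph V(1))
  show "chi_ig_AB (delete_vertex (gadget_graph m) x) = m + 4" if "x \<in> {8, 9}"
  proof (cases "x = 8")
    case True
    then show ?thesis using g.delete_a by (simp add: chi_delete_vertex verts_gadget_graph V(1))
  next
    case False
    then show ?thesis using h.delete_a that by (simp add: chi_delete_vertex verts_gadget_graph V(2))
  qed
qed

theorem proposition20:
  fixes n :: nat
  assumes "n \<ge> 2"
  shows "\<exists>G :: nat graph. simple_graph G \<and> mixed_game_vertex_critical G \<and>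
    {int (chi_ig_AB G) - int (chi_ig_AB (delete_vertex G x)) | x. x \<in> verts G}
      = {1, - 2 * int n + 3, - 2 * int n + 1}"
proof (intro exI conjI)
  \<comment> \<open>With \<open>2 * n\<close> outer pairs the value is 5, and it becomes 4,
    \<open>2 * n + 2\<close> or \<open>2 * n + 4\<close> after a deletion. The last two exceed 5
    because \<open>n \<ge> 2\<close>.\<close>
  let ?G = "gadget_graph (2 * n)"
  have m: "3 \<le> 2 * n" "even (2 * n)" using assms by auto
  note chi = chi_gadget_graph[OF m]
  have V: "verts ?G = pairs {6..<6 + 2 * n} \<union> (pairs {..<4} \<union> {10}) \<union> {8, 9}"
    by (auto simp: verts_gadget_graph gadget_verts_def)
  \<comment> \<open>A vertex of the outer crown, which shows that the difference 1 occurs.\<close>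
  have mem: "12 \<in> pairs {6..<6 + 2 * n}" using assms by (simp add: pairs_def)
  show "simple_graph ?G" by (rule simple_gadget_graph)
  show "mixed_game_vertex_critical ?G"
    unfolding mixed_game_vertex_critical_def
  proof (intro conjI)
    show "\<forall>x\<in>verts ?G. chi_ig_AB (delete_vertex ?G x) \<noteq> chi_ig_AB ?G"
      unfolding V using chi assms by fastforce
    show "\<exists>y\<in>verts ?G. chi_ig_AB (delete_vertex ?G y) < chi_ig_AB ?G"
      by (rule bexI[of _ 12]) (use mem chi(1) chi(2)[OF mem] in \<open>auto simp: V\<close>)
    show "\<exists>y\<in>verts ?G. chi_ig_AB (delete_vertex ?G y) > chi_ig_AB ?G"
      by (rule bexI[of _ 8]) (use assms chi(1) chi(4)[of 8] in \<open>auto simp: V\<close>)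
  qed
  let ?d = "\<lambda>x. int (chi_ig_AB ?G) - int (chi_ig_AB (delete_vertex ?G x))"
  have "?d ` pairs {6..<6 + 2 * n} = {1}"
    using mem chi(1,2) by auto
  moreover have "?d ` (pairs {..<4} \<union> {10}) = {- 2 * int n + 3}"
    using chi(1,3) by auto
  moreover have "?d ` {8, 9} = {- 2 * int n + 1}"
    using chi(1,4) by auto
  moreover have "{?d x | x. x \<in> verts ?G} = ?d ` verts ?G" by auto
  ultimately show "{?d x | x. x \<in> verts ?G} = {1, - 2 * int n + 3, - 2 * int n + 1}"
    unfolding V image_Un by auto
qed

end
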